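(* There exists a potential $V:\mathbb{Z}^+\to\mathbb{R}$ such that the half-line operator $h_V^+$ has $0$ as an eigenvalue, has infinitely many eigenvalues outside $[-2,2]$, and these eigenvalues $\{E_n\}_{n\ge1}$, ordered so that $|E_1|\ge|E_2|\ge\cdots$, satisfy $$C_1\, b^n \le |E_n|-2 \le C_2\, c^n \quad\text{for all } n\ge1$$ for suitable constants $0<b\le c<1$ and $C_1,C_2>0$.
   Context: $\mathbb{Z}^+=\{0,1,2,\dots\}$. For $V:\mathbb{Z}^+\to\mathbb{R}$, the half-line discrete Schrödinger operator $h_V^+$ acts on $\ell^2(\mathbb{Z}^+)$ by $[h_V^+\phi](n)=\phi(n+1)+\phi(n-1)+V(n)\phi(n)$ with the convention $\phi(-1)=0$. Eigenvalues of $h_V^+$ lying outside $[-2,2]$ are called bound states. *)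

theory Defs
  imports Complex_Main
begin

text \<open>Half-line discrete Schroedinger operator with Dirichlet convention phi(-1) = 0,
  acting on sequences indexed by nat = {0,1,2,...}.\<close>
definition half_schr :: "(nat \<Rightarrow> real) \<Rightarrow> (nat \<Rightarrow> real) \<Rightarrow> nat \<Rightarrow> real" where
  "half_schr V \<phi> n = \<phi> (Suc n) + (if n = 0 then 0 else \<phi> (n - 1)) + V n * \<phi> n"

definition l2_seq :: "(nat \<Rightarrow> real) \<Rightarrow> bool" where
  "l2_seq \<phi> \<longleftrightarrow> summable (\<lambda>n. (\<phi> n)\<^sup>2)"

definition half_eigenvalue :: "(nat \<Rightarrow> real) \<Rightarrow> real \<Rightarrow> bool" where
  "half_eigenvalue V E \<longleftrightarrow>
     (\<exists>\<phi>. l2_seq \<phi> \<and> \<phi> \<noteq> (\<lambda>_. 0) \<and> (\<forall>n. half_schr V \<phi> n = E * \<phi> n))"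

definition bound_states :: "(nat \<Rightarrow> real) \<Rightarrow> real set" where
  "bound_states V = {E. half_eigenvalue V E \<and> E \<notin> {-2..2}}"

end

theory Submission
  imports Defs "HOL-Analysis.Analysis"
begin

text \<open>
  The potential is read off from its zero-energy solution: for \<open>\<phi> n = (-1)^(n div 2) g n\<close> with
  \<open>g (n + 1) = g n / (1 + t n)\<close>, the equation at energy \<open>0\<close> forces an alternating potential
  \<open>V n = (-1)^n (t (n - 1) + t n / (1 + t n))\<close>. With \<open>t n = 16 / 2^k\<close> for \<open>2^k \<le> n < 2^(k+1)\<close>
  the solution is square summable.

  \<^item> Inside a dyadic block of length \<open>L\<close> the potential is \<open>(-1)^n w\<close> with \<open>w \<ge> 16 / L\<close>, where an explicit
  sine profile vanishing at the ends solves the equation at an energy above \<open>2 + 1 / L^2\<close>. By Sturm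
  comparison every solution of lower energy changes sign in the block. The number of sign changes
  of the Dirichlet solution is locally constant in the energy except at eigenvalues, where it jumps
  by one, so there are \<open>n\<close> eigenvalues above \<open>2 + 4^-(n+1)\<close>.
  \<^item> The alternating signs make \<open>V\<close> the difference of a sequence \<open>F\<close> of size \<open>O(1/n)\<close>. Summation by parts
  bounds the potential energy by the kinetic energy plus \<open>O(F^2)\<close>, so Dirichlet conditions at a
  geometrically growing set of sites \<open>x_0, ..., x_K\<close> push the quadratic form of \<open>h\<close> below
  \<open>2 + O(x_K^-2)\<close>. This argument is symmetric under \<open>V \<mapsto> -V\<close> and hence also covers energies below \<open>-2\<close>.
\<close>

subsection \<open>The potential\<close>

text \<open>Halving the argument encodes the dyadic step function without logarithms, so bounds of
  order \<open>1 / n\<close> on both sides follow by strong induction.\<close>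

fun amp :: "nat \<Rightarrow> real" where
  "amp n = (if n < 2 then 16 else amp (n div 2) / 2)"

declare amp.simps [simp del]

lemma amp_0: "amp 0 = 16" and amp_1: "amp (Suc 0) = 16"
  by (simp_all add: amp.simps)

lemma amp_double: "n \<ge> 2 \<Longrightarrow> amp n = amp (n div 2) / 2"
  by (subst amp.simps) simp

lemma amp_pos: "amp n > 0"
proof (induction n rule: less_induct)
  case (less n)
  then show ?case by (cases "n < 2") (simp_all add: amp.simps[of n])
qed

text \<open>From 2 on, blocks begin at even numbers, so an even site shares its block with its
  successor. This pairing lets \<open>pot\<close> telescope.\<close>

lemma amp_even_Suc: "even n \<Longrightarrow> amp (Suc n) = amp n"
  by (cases "n = 0") (auto simp: amp_0 amp_1 amp_double elim!: evenE)

lemma amp_upper: "amp n * real (Suc n) \<le> 32"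
proof (induction n rule: less_induct)
  case (less n)
  show ?case
  proof (cases "n < 2")
    case False
    have "Suc n \<le> 2 * Suc (n div 2)" by presburger
    then have "real (Suc n) \<le> 2 * real (Suc (n div 2))"
      by (metis of_nat_le_iff of_nat_mult of_nat_numeral)
    then have "amp n * real (Suc n) \<le> amp n * (2 * real (Suc (n div 2)))"
      using amp_pos[of n] by (intro mult_left_mono) auto
    also have "\<dots> = amp (n div 2) * real (Suc (n div 2))"
      using False by (simp add: amp_double)
    also have "\<dots> \<le> 32" using False by (intro less) auto
    finally show ?thesis .
  qed (auto simp: amp.simps[of n] less_Suc_eq numeral_2_eq_2)
qed

lemma amp_lower: "n \<ge> 1 \<Longrightarrow> 16 \<le> amp n * real n"
proof (induction n rule: less_induct)
  case (less n)
  show ?case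
  proof (cases "n < 2")
    case False
    have "16 \<le> amp (n div 2) * real (n div 2)" using False by (intro less) auto
    also have "\<dots> = amp n * (2 * real (n div 2))" using False by (simp add: amp_double)
    also have "\<dots> \<le> amp n * real n" using amp_pos[of n] by (intro mult_left_mono) linarith+
    finally show ?thesis .
  qed (use less.prems in \<open>auto simp: amp.simps[of n]\<close>)
qed

lemma amp_dyadic: "2 ^ k \<le> n \<Longrightarrow> n < 2 ^ Suc k \<Longrightarrow> amp n = 16 / 2 ^ k"
proof (induction k arbitrary: n)
  case 0
  then have "n = 1" by auto
  then show ?case by (simp add: amp_1)
next
  case (Suc k)
  from Suc.prems have "2 ^ k \<le> n div 2" "n div 2 < 2 ^ Suc k" by auto
  from Suc.IH[OF this] have "amp (n div 2) = 16 / 2 ^ k" .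
  moreover have "n \<ge> 2" using Suc.prems(1) order_trans[of 2 "2 ^ Suc k" n] by simp
  ultimately show ?case by (simp add: amp_double)
qed

text \<open>Site 0 has no left neighbour, so the zero-energy equation there gives only
  \<open>- g 1 / g 0\<close>.\<close>

definition pot :: "nat \<Rightarrow> real" where
  "pot n = (if n = 0 then - 1 / (1 + amp 0)
            else (- 1) ^ n * (amp (n - 1) + amp n / (1 + amp n)))"

text \<open>This is the sequence \<open>F\<close> of the overview: the discrete antiderivative of
  \<open>pot\<close> normalised to vanish at infinity. The value at 0 is then forced by
  \<open>pot 0\<close>.\<close>

definition prim :: "nat \<Rightarrow> real" where
  "prim n = (if n = 0 then 1 else if odd n then amp n / (1 + amp n) else - amp (n - 1))"

lemma pot_eq_prim_diff: "pot n = prim (Suc n) - prim n"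
proof (cases "n = 0")
  case False
  show ?thesis
  proof (cases "even n")
    case True
    then show ?thesis using False amp_even_Suc[of n] by (simp add: pot_def prim_def)
  next
    case odd: False
    then have "amp (Suc (n - 1)) = amp (n - 1)" by (intro amp_even_Suc) auto
    then show ?thesis using False odd by (simp add: pot_def prim_def)
  qed
qed (simp add: pot_def prim_def amp_0 amp_1)

lemma abs_prim_Suc_le: "\<bar>prim (Suc n)\<bar> \<le> 32 / real (Suc n)"
proof -
  have "\<bar>prim (Suc n)\<bar> \<le> amp n"
  proof (cases "even n")
    case True
    have "amp n / (1 + amp n) \<le> amp n / 1"
      using amp_pos[of n] by (intro divide_left_mono) auto
    then show ?thesis using True amp_pos[of n] amp_even_Suc[of n] by (simp add: prim_def)
  qed (use amp_pos[of n] in \<open>simp add: prim_def\<close>)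
  also have "\<dots> \<le> 32 / real (Suc n)" using amp_upper[of n] by (simp add: field_simps)
  finally show ?thesis .
qed

lemma pot_tendsto_0: "pot \<longlonglongrightarrow> 0"
proof -
  have "(\<lambda>n. 32 / real (Suc n)) \<longlonglongrightarrow> 0"
    using tendsto_mult[OF tendsto_const[of "32::real"] LIMSEQ_inverse_real_of_nat]
    by (simp add: field_simps)
  then have "(\<lambda>n. prim (Suc n)) \<longlonglongrightarrow> 0"
    by (rule Lim_null_comparison[rotated]) (use abs_prim_Suc_le in auto)
  moreover from this have "prim \<longlonglongrightarrow> 0" by (rule LIMSEQ_imp_Suc)
  ultimately have "(\<lambda>n. prim (Suc n) - prim n) \<longlonglongrightarrow> 0 - 0" by (rule tendsto_diff)
  then show ?thesis by (simp add: pot_eq_prim_diff[symmetric])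
qed

subsection \<open>The zero-energy eigenfunction\<close>

fun decay :: "nat \<Rightarrow> real" where
  "decay 0 = 1"
| "decay (Suc n) = decay n / (1 + amp n)"

lemma decay_pos: "decay n > 0"
  using amp_pos by (induction n) (auto intro!: divide_pos_pos add_pos_pos)

text \<open>Since \<open>amp n \<ge> 1 / (n + 1)\<close>, each factor \<open>1 / (1 + amp n)\<close>
  is at most \<open>(n + 1) / (n + 2)\<close>, and the product of these telescopes.\<close>

lemma decay_le: "decay n \<le> 1 / real (Suc n)"
proof (induction n)
  case (Suc n)
  have "real (Suc (Suc n)) / real (Suc n) \<le> 1 + amp n"
  proof (cases "n = 0")
    case False
    then have "16 / real n \<le> amp n" using amp_lower[of n] by (simp add: field_simps)
    moreover have "1 / real (Suc n) \<le> 16 / real n" using False by (simp add: field_simps)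
    moreover have "real (Suc (Suc n)) / real (Suc n) = 1 + 1 / real (Suc n)"
      by (simp add: field_simps)
    ultimately show ?thesis by linarith
  qed (simp add: amp_0)
  then have "decay n / (1 + amp n) \<le> (1 / real (Suc n)) / (real (Suc (Suc n)) / real (Suc n))"
    using Suc.IH decay_pos[of n] by (intro frac_le) auto
  also have "\<dots> = 1 / real (Suc (Suc n))" by simp
  finally show ?case by simp
qed simp

lemma half_eigenvalue_pot_0: "half_eigenvalue pot 0"
  unfolding half_eigenvalue_def
proof (intro exI conjI allI)
  define \<phi> where "\<phi> n = (- 1) ^ (n div 2) * decay n" for n
  have "summable (\<lambda>n. 1 / real (Suc n) ^ 2)"
    using inverse_power_summable[of 2, where 'a = real]
    by (subst summable_Suc_iff) (simp add: field_simps)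
  then show "l2_seq \<phi>"
    unfolding l2_seq_def
  proof (rule summable_comparison_test')
    fix n
    have "(decay n)\<^sup>2 \<le> (1 / real (Suc n))\<^sup>2"
      using decay_le[of n] decay_pos[of n] by (intro power_mono) auto
    then show "norm ((\<phi> n)\<^sup>2) \<le> 1 / real (Suc n) ^ 2"
      by (simp add: \<phi>_def power_mult_distrib power_divide flip: power_mult)
  qed
  have "\<phi> 0 \<noteq> 0" by (simp add: \<phi>_def)
  then show "\<phi> \<noteq> (\<lambda>_. 0)" by metis
  fix n
  show "half_schr pot \<phi> n = 0 * \<phi> n"
  proof (cases n)
    case 0
    then show ?thesis by (simp add: half_schr_def \<phi>_def pot_def amp_0)
  next
    case (Suc m)
    define a where "a = amp m"
    define b where "b = amp (Suc m)"
    have pos: "a > 0" "b > 0" using amp_pos by (auto simp: a_def b_def)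
    define e where "e = (- 1 :: real) ^ (n div 2)"
    define d where "d = decay n"
    have decay: "decay (Suc n) = d / (1 + b)" "decay m = (1 + a) * d"
      using Suc pos by (auto simp: a_def b_def d_def)
    \<comment> \<open>The signs run \<open>+ + - -\<close> with period four, so the two neighbours
      of a site have opposite signs and the hopping terms subtract.\<close>
    have sgn: "(- 1) ^ (Suc n div 2) = (- 1) ^ n * e" "(- 1) ^ (m div 2) = - ((- 1) ^ n * e)"
      using Suc by (cases "even n"; auto simp: e_def elim!: evenE oddE)+
    have "half_schr pot \<phi> n = (- 1) ^ n * e * (d / (1 + b) - (1 + a) * d + (a + b / (1 + b)) * d)"
    proof -
      have "\<phi> (Suc n) = (- 1) ^ n * e * (d / (1 + b))" "\<phi> m = - ((- 1) ^ n * e * ((1 + a) * d))"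
        "\<phi> n = e * d" unfolding \<phi>_def decay sgn by (simp_all add: e_def d_def)
      moreover have "pot n = (- 1) ^ n * (a + b / (1 + b))"
        using Suc by (simp add: pot_def a_def b_def)
      ultimately have "half_schr pot \<phi> n = (- 1) ^ n * e * (d / (1 + b))
          + - ((- 1) ^ n * e * ((1 + a) * d)) + (- 1) ^ n * (a + b / (1 + b)) * (e * d)"
        using Suc by (simp only: half_schr_def) simp
      then show ?thesis by (simp only: algebra_simps)
    qed
    also have "d / (1 + b) - (1 + a) * d + (a + b / (1 + b)) * d = 0"
      using pos by (simp add: field_simps)
    finally show ?thesis by simp
  qed
qed

subsection \<open>Sign changes and existence of eigenvalues\<close>

text \<open>The Dirichlet solution at energy \<open>E\<close>, normalised at site 0. Each of its
  values is a polynomial in \<open>E\<close>.\<close>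

fun shoot :: "(nat \<Rightarrow> real) \<Rightarrow> real \<Rightarrow> nat \<Rightarrow> real" where
  "shoot V E 0 = 1"
| "shoot V E (Suc 0) = E - V 0"
| "shoot V E (Suc (Suc n)) = (E - V (Suc n)) * shoot V E (Suc n) - shoot V E n"

lemma half_schr_shoot: "half_schr V (shoot V E) n = E * shoot V E n"
  by (cases n) (auto simp: half_schr_def algebra_simps)

lemma continuous_shoot: "isCont (\<lambda>E. shoot V E n) E"
  by (induction n rule: induct_nat_012) (simp_all add: continuous_intros)

lemma tendsto_shoot: "((\<lambda>E. shoot V E n) \<longlongrightarrow> shoot V E n) (nhds E)"
  using continuous_shoot tendsto_at_iff_tendsto_nhds[of "\<lambda>E. shoot V E n" E]
  unfolding isCont_def by blast

text \<open>Two adjacent zeros would propagate backwards to site 0, where the value is 1.\<close>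

lemma shoot_consecutive: "shoot V E n \<noteq> 0 \<or> shoot V E (Suc n) \<noteq> 0"
  by (induction n) auto

lemma eventually_shoot_sign:
  assumes "shoot V E n \<noteq> 0"
  shows "\<forall>\<^sub>F E' in nhds E. shoot V E' n * shoot V E n > 0"
proof -
  have "((\<lambda>E'. shoot V E' n * shoot V E n) \<longlongrightarrow> shoot V E n * shoot V E n) (nhds E)"
    by (intro tendsto_mult tendsto_const tendsto_shoot)
  moreover have "shoot V E n * shoot V E n > 0" using assms
    by (simp add: zero_less_mult_iff) linarith
  ultimately show ?thesis by (rule order_tendstoD(1))
qed

section \<open>Stability of the number of sign changes\<close>

text \<open>Counting a zero together with the site before it makes the number of crossings
  stable under perturbation.\<close>

definition crossing :: "(nat \<Rightarrow> real) \<Rightarrow> nat \<Rightarrow> bool" where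
  "crossing u n \<longleftrightarrow> u n \<noteq> 0 \<and> u n * u (Suc n) \<le> 0"

definition crossings_below :: "(nat \<Rightarrow> real) \<Rightarrow> nat \<Rightarrow> nat" where
  "crossings_below u m = card {n. n < m \<and> crossing u n}"

definition crossings :: "(nat \<Rightarrow> real) \<Rightarrow> nat" where
  "crossings u = card {n. crossing u n}"

lemma crossings_below_Suc:
  "crossings_below u (Suc m) = crossings_below u m + (if crossing u m then 1 else 0)"
proof -
  have "{n. n < Suc m \<and> crossing u n}
      = (if crossing u m then insert m {n. n < m \<and> crossing u n} else {n. n < m \<and> crossing u n})"
    by (auto simp: less_Suc_eq)
  then show ?thesis by (simp add: crossings_below_def)
qed

text \<open>Nonzero values keep their sign nearby. A zero at site \<open>k\<close> lies between
  values of opposite sign, so after a perturbation exactly one of the sites \<open>k - 1\<close> and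
  \<open>k\<close> is a crossing. The nonzero value at \<open>m\<close> keeps a crossing from
  escaping past \<open>m\<close>.\<close>

lemma eventually_crossings_below_eq:
  "shoot V E m \<noteq> 0 \<Longrightarrow>
    \<forall>\<^sub>F E' in nhds E. crossings_below (shoot V E') m = crossings_below (shoot V E) m"
proof (induction m rule: less_induct)
  case (less m)
  note sgn = eventually_shoot_sign[of V E]
  show ?case
  proof (cases m)
    case 0
    then show ?thesis by (simp add: crossings_below_def)
  next
    case (Suc k)
    show ?thesis
    proof (cases "shoot V E k = 0")
      case False
      from less.IH[OF _ False] Suc
      have "\<forall>\<^sub>F E' in nhds E. crossings_below (shoot V E') k = crossings_below (shoot V E) k" by simp
      with sgn[OF False] sgn[OF less.prems] show ?thesis
      proof eventually_elim
        case (elim E')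
        then have "crossing (shoot V E') k \<longleftrightarrow> crossing (shoot V E) k"
          using False less.prems Suc
          by (auto simp: crossing_def zero_less_mult_iff mult_le_0_iff)
        with elim show ?case by (simp add: Suc crossings_below_Suc)
      qed
    next
      case True
      then obtain l where l: "k = Suc l" by (cases k) auto
      have opp: "shoot V E m = - shoot V E l"
        using True by (simp add: Suc l)
      with less.prems have nz: "shoot V E l \<noteq> 0" by simp
      from less.IH[OF _ nz] Suc l
      have "\<forall>\<^sub>F E' in nhds E. crossings_below (shoot V E') l = crossings_below (shoot V E) l" by simp
      with sgn[OF nz] sgn[OF less.prems] show ?thesis
      proof eventually_elim
        case (elim E')
        have "crossing (shoot V E) l" "\<not> crossing (shoot V E) (Suc l)"
          using True nz by (auto simp: crossing_def l)
        moreover have "crossing (shoot V E') l \<noteq> crossing (shoot V E') (Suc l)"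
          using elim(1,2) opp nz Suc l
          by (auto simp: crossing_def zero_less_mult_iff mult_le_0_iff
              simp del: shoot.simps)
        ultimately show ?case using elim(3) by (simp add: Suc l crossings_below_Suc)
      qed
    qed
  qed
qed

section \<open>Growth and decay of solutions far out\<close>

definition growing :: "(nat \<Rightarrow> real) \<Rightarrow> nat \<Rightarrow> bool" where
  "growing u n \<longleftrightarrow> (u n)\<^sup>2 < u n * u (Suc n)"

lemma growing_not_crossing: "growing u n \<Longrightarrow> \<not> crossing u n"
  unfolding growing_def crossing_def using zero_le_power2[of "u n"] by linarith

text \<open>\<open>growing\<close> says, without division, that the ratio \<open>r\<close> of
  successive values exceeds 1. The recursion turns \<open>r\<close> into
  \<open>E - V - 1 / r\<close>, which is above 1 if \<open>E - V \<ge> 2\<close>.\<close>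

lemma growing_Suc:
  assumes "growing (shoot V E) n" "V (Suc n) \<le> E - 2"
  shows "growing (shoot V E) (Suc n)"
proof -
  define a where "a = shoot V E n"
  define b where "b = shoot V E (Suc n)"
  have ab: "a\<^sup>2 < a * b" using assms(1) by (simp add: growing_def a_def b_def)
  have "a \<noteq> b" using ab by (auto simp: power2_eq_square)
  then have "0 < (a - b)\<^sup>2" by simp
  then have "a * b < b\<^sup>2" using ab by (simp add: power2_diff)
  moreover have "2 * b\<^sup>2 \<le> (E - V (Suc n)) * b\<^sup>2" using assms(2) by (intro mult_right_mono) auto
  moreover have "b * shoot V E (Suc (Suc n)) = (E - V (Suc n)) * b\<^sup>2 - a * b"
    by (simp add: a_def b_def algebra_simps power2_eq_square)
  ultimately show ?thesis unfolding growing_def b_def[symmetric] by linarith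
qed

lemma growing_mono:
  assumes "growing (shoot V E) m" "\<And>n. n > m \<Longrightarrow> V n \<le> E - 2" "m \<le> n"
  shows "growing (shoot V E) n"
  using assms(3)
proof (induction n rule: dec_induct)
  case (step n)
  then show ?case using assms(2) by (intro growing_Suc) auto
qed (rule assms(1))

text \<open>After a sign change the term \<open>- u n\<close> in the recursion has the sign of
  \<open>u (n + 1)\<close> and reinforces it; if \<open>u (n + 1)\<close> is zero, growth starts one
  site later.\<close>

lemma growing_after_crossing:
  assumes "crossing (shoot V E) n" "\<And>k. k > n \<Longrightarrow> V k < E - 2"
  shows "shoot V E (Suc n) \<noteq> 0 \<and> growing (shoot V E) (Suc n) \<or>
         shoot V E (Suc n) = 0 \<and> growing (shoot V E) (Suc (Suc n))"
proof (cases "shoot V E (Suc n) = 0")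
  case True
  define a where "a = shoot V E (Suc (Suc n))"
  have "a \<noteq> 0" using True shoot_consecutive[of V E "Suc n"] by (simp add: a_def del: shoot.simps)
  then have "1 * a\<^sup>2 < (E - V (Suc (Suc n))) * a\<^sup>2"
    using assms(2)[of "Suc (Suc n)"] by (intro mult_strict_right_mono) auto
  moreover have "shoot V E (Suc (Suc (Suc n))) = (E - V (Suc (Suc n))) * a"
    by (subst shoot.simps(3)) (simp only: True a_def diff_0_right)
  ultimately show ?thesis using True
    by (simp add: growing_def power2_eq_square mult_ac flip: a_def del: shoot.simps)
next
  case False
  define a where "a = shoot V E n"
  define b where "b = shoot V E (Suc n)"
  have ab: "a * b \<le> 0" using assms(1) by (simp add: crossing_def a_def b_def)
  have "1 * b\<^sup>2 < (E - V (Suc n)) * b\<^sup>2"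
    using assms(2)[of "Suc n"] False by (intro mult_strict_right_mono) (auto simp: b_def)
  moreover have "b * shoot V E (Suc (Suc n)) = (E - V (Suc n)) * b\<^sup>2 - a * b"
    by (simp add: a_def b_def algebra_simps power2_eq_square)
  ultimately have "b\<^sup>2 < b * shoot V E (Suc (Suc n))" using ab by linarith
  then show ?thesis using False by (simp add: growing_def flip: b_def del: shoot.simps)
qed

lemma no_second_crossing:
  assumes "crossing (shoot V E) n" "crossing (shoot V E) n'" "n < n'"
    and "\<And>k. k > n \<Longrightarrow> V k < E - 2"
  shows False
proof -
  have g: "growing (shoot V E) n'" if "growing (shoot V E) m" "n < m" "m \<le> n'" for m
    using that assms(4) by (intro growing_mono[of V E m n']) (auto intro: less_imp_le)
  have "shoot V E (Suc n) \<noteq> 0 \<and> growing (shoot V E) (Suc n) \<or>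
        shoot V E (Suc n) = 0 \<and> growing (shoot V E) (Suc (Suc n))"
    using growing_after_crossing[OF assms(1)] assms(4) by blast
  then show False
  proof (elim disjE conjE)
    assume "growing (shoot V E) (Suc n)"
    then show False using g[of "Suc n"] growing_not_crossing assms by auto
  next
    assume z: "shoot V E (Suc n) = 0" "growing (shoot V E) (Suc (Suc n))"
    then have "n' \<noteq> Suc n" using assms(2) by (auto simp: crossing_def)
    then show False using z g[of "Suc (Suc n)"] growing_not_crossing assms by auto
  qed
qed

text \<open>A crossing past \<open>m\<close> starts permanent growth, which excludes a second
  one.\<close>

lemma crossings_bounds:
  assumes "\<And>k. k > m \<Longrightarrow> V k < E - 2"
  shows "finite {n. crossing (shoot V E) n}"
    and "crossings_below (shoot V E) m \<le> crossings (shoot V E)"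
    and "crossings (shoot V E) \<le> Suc (crossings_below (shoot V E) m)"
proof -
  define C where "C = {n. crossing (shoot V E) n}"
  define A where "A = {n. n < m \<and> crossing (shoot V E) n}"
  define B where "B = {n. n \<ge> m \<and> crossing (shoot V E) n}"
  have not_less: "\<not> a < b" if "a \<in> B" "b \<in> B" for a b
  proof
    assume "a < b"
    then show False
      using that no_second_crossing[of V E a b] assms by (force simp: B_def)
  qed
  have "a = b" if "a \<in> B" "b \<in> B" for a b
    using not_less[OF that] not_less[OF that(2) that(1)] by simp
  then obtain x where "B \<subseteq> {x}" by blast
  then have B: "finite B" "card B \<le> 1"
    using card_mono[of "{x}" B] by (auto intro: finite_subset)
  have A: "finite A" by (simp add: A_def)
  have C: "C = A \<union> B" by (auto simp: A_def B_def C_def)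
  then show "finite {n. crossing (shoot V E) n}" using A B by (simp flip: C_def)
  have "card C = card A + card B"
    unfolding C using A B by (intro card_Un_disjoint) (auto simp: A_def B_def)
  then show "crossings_below (shoot V E) m \<le> crossings (shoot V E)"
    "crossings (shoot V E) \<le> Suc (crossings_below (shoot V E) m)"
    using B(2) by (simp_all add: crossings_def crossings_below_def flip: A_def C_def)
qed

lemma crossings_eq_below:
  assumes "\<And>n. n \<ge> m \<Longrightarrow> \<not> crossing u n"
  shows "crossings u = crossings_below u m"
proof -
  have "n < m" if "crossing u n" for n using assms[of n] that by (cases "n < m") auto
  then have "{n. crossing u n} = {n. n < m \<and> crossing u n}" by blast
  then show ?thesis by (simp add: crossings_def crossings_below_def)
qed

lemma crossings_growing:
  assumes "growing (shoot V E) m" "\<And>n. n > m \<Longrightarrow> V n \<le> E - 2"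
  shows "crossings (shoot V E) = crossings_below (shoot V E) m"
  using growing_mono[OF assms] growing_not_crossing by (intro crossings_eq_below) auto

text \<open>A zero or a sign change would trigger growth, so the sign is constant past
  \<open>m\<close>. Inserting \<open>u (n + 2) / u (n + 1) \<le> 1\<close> into the recursion then
  bounds \<open>u n / u (n + 1)\<close> below by \<open>1 + \<delta>\<close>.\<close>

lemma not_growing_imp_decaying:
  assumes "\<And>n. n \<ge> m \<Longrightarrow> \<not> growing (shoot V E) n" "\<delta> > 0"
    and V: "\<And>n. n > m \<Longrightarrow> V n \<le> E - (2 + \<delta>)"
    and n: "n \<ge> m"
  shows "shoot V E n * shoot V E (Suc n) > 0"
    and "(1 + \<delta>) * \<bar>shoot V E (Suc n)\<bar> \<le> \<bar>shoot V E n\<bar>"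
proof -
  have V': "\<And>n. n > m \<Longrightarrow> V n < E - 2" using V \<open>\<delta> > 0\<close> by force
  have pos: "shoot V E n * shoot V E (Suc n) > 0" if n: "n \<ge> m" for n
  proof (rule ccontr)
    assume le: "\<not> ?thesis"
    have "\<exists>k\<ge>m. crossing (shoot V E) k"
    proof (cases "shoot V E n = 0")
      case True
      have nz: "shoot V E (Suc n) \<noteq> 0" using True shoot_consecutive by blast
      then have "1 * (shoot V E (Suc n))\<^sup>2 < (E - V (Suc n)) * (shoot V E (Suc n))\<^sup>2"
        using V'[of "Suc n"] n by (intro mult_strict_right_mono) auto
      then have "growing (shoot V E) (Suc n)"
        using True by (simp add: growing_def power2_eq_square mult_ac)
      then show ?thesis using assms(1)[of "Suc n"] n by auto
    qed (use le n in \<open>auto simp: crossing_def not_less\<close>)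
    then obtain k where k: "k \<ge> m" "crossing (shoot V E) k" by blast
    then show False using growing_after_crossing[OF k(2)] V' assms(1)[of "Suc k"] assms(1)[of "Suc (Suc k)"]
      by auto
  qed
  show "shoot V E n * shoot V E (Suc n) > 0" using pos[OF n] .
  define a where "a = shoot V E n"
  define b where "b = shoot V E (Suc n)"
  define c where "c = shoot V E (Suc (Suc n))"
  have ab: "a * b > 0" and bc: "b * c > 0"
    using pos[of n] pos[of "Suc n"] n by (auto simp: a_def b_def c_def simp del: shoot.simps)
  have "b * c \<le> b\<^sup>2" using assms(1)[of "Suc n"] n
    by (simp add: growing_def b_def c_def del: shoot.simps)
  moreover have "(2 + \<delta>) * b\<^sup>2 \<le> (E - V (Suc n)) * b\<^sup>2"
    using V[of "Suc n"] n by (intro mult_right_mono) auto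
  moreover have "b * c = (E - V (Suc n)) * b\<^sup>2 - a * b"
    by (simp add: a_def b_def c_def algebra_simps power2_eq_square)
  ultimately have "(1 + \<delta>) * b\<^sup>2 \<le> a * b" by (simp add: algebra_simps)
  also have "a * b = \<bar>a\<bar> * \<bar>b\<bar>" using ab by (simp flip: abs_mult)
  finally have "((1 + \<delta>) * \<bar>b\<bar>) * \<bar>b\<bar> \<le> \<bar>a\<bar> * \<bar>b\<bar>" by (simp add: power2_eq_square mult_ac)
  moreover have "\<bar>b\<bar> > 0" using ab by auto
  ultimately show "(1 + \<delta>) * \<bar>shoot V E (Suc n)\<bar> \<le> \<bar>shoot V E n\<bar>"
    unfolding a_def[symmetric] b_def[symmetric] by (rule mult_right_le_imp_le)
qed

lemma not_growing_imp_eigenvalue: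
  assumes "\<And>n. n \<ge> m \<Longrightarrow> \<not> growing (shoot V E) n" "\<delta> > 0"
    and V: "\<And>n. n > m \<Longrightarrow> V n \<le> E - (2 + \<delta>)"
  shows "half_eigenvalue V E"
  unfolding half_eigenvalue_def
proof (intro exI conjI allI)
  have "shoot V E 0 \<noteq> 0" by simp
  then show "shoot V E \<noteq> (\<lambda>_. 0)" by metis
  show "half_schr V (shoot V E) n = E * shoot V E n" for n by (rule half_schr_shoot)
  show "l2_seq (shoot V E)"
    unfolding l2_seq_def
  proof (rule summable_ratio_test[of "inverse (1 + \<delta>)"])
    show "inverse (1 + \<delta>) < 1" using \<open>\<delta> > 0\<close> by (simp add: inverse_less_1_iff)
    fix n assume n: "m \<le> n"
    define a where "a = \<bar>shoot V E n\<bar>"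
    define b where "b = \<bar>shoot V E (Suc n)\<bar>"
    have le: "(1 + \<delta>) * b \<le> a" "a \<ge> 0" "b \<ge> 0"
      using not_growing_imp_decaying(2)[OF assms n] by (auto simp: a_def b_def)
    have "1 * b \<le> (1 + \<delta>) * b" using \<open>\<delta> > 0\<close> le(3) by (intro mult_right_mono) auto
    with le have "b \<le> a" by linarith
    have "(1 + \<delta>) * b * b \<le> a * a"
      using le \<open>b \<le> a\<close> by (intro mult_mono) auto
    then have "b\<^sup>2 \<le> inverse (1 + \<delta>) * a\<^sup>2"
      using \<open>\<delta> > 0\<close> by (simp add: field_simps power2_eq_square)
    then show "norm ((shoot V E (Suc n))\<^sup>2) \<le> inverse (1 + \<delta>) * norm ((shoot V E n)\<^sup>2)"
      by (simp add: a_def b_def)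
  qed
qed

text \<open>Either the solution grows at some site past \<open>m\<close>, an open condition in the
  energy that freezes the count, or it decays; then \<open>E\<close> is an eigenvalue and a
  perturbation adds at most one crossing far out.\<close>

lemma eventually_crossings_near:
  assumes V: "V \<longlonglongrightarrow> 0" and E: "E > 2"
  shows "\<forall>\<^sub>F E' in nhds E. crossings (shoot V E') \<in> {crossings (shoot V E), Suc (crossings (shoot V E))}"
    and "\<not> half_eigenvalue V E \<Longrightarrow>
      \<forall>\<^sub>F E' in nhds E. crossings (shoot V E') = crossings (shoot V E)"
proof -
  \<comment> \<open>Half the distance to 2 leaves room for energies \<open>E' > E - \<delta>\<close>
    to stay above \<open>2 + V n\<close> for all \<open>n \<ge> m\<close>.\<close>
  define \<delta> where "\<delta> = (E - 2) / 2"
  have \<delta>: "\<delta> > 0" using E by (simp add: \<delta>_def)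
  have "\<forall>\<^sub>F n in sequentially. V n < \<delta> / 2" using V \<delta> by (intro order_tendstoD(2)[of V 0]) auto
  then obtain m where m: "\<And>n. n \<ge> m \<Longrightarrow> V n < \<delta> / 2"
    unfolding eventually_sequentially by blast
  have near: "\<forall>\<^sub>F E' in nhds E. E' > E - \<delta>"
    using \<delta> by (intro order_tendstoD(1)[OF filterlim_ident]) auto
  have bnd: "V n < E' - 2" if "E' > E - \<delta>" "n \<ge> m" for E' n
    using m[OF that(2)] that(1) \<delta> by (simp add: \<delta>_def field_simps)
  have loc: "\<forall>\<^sub>F E' in nhds E. crossings (shoot V E') = crossings (shoot V E)"
    if g: "growing (shoot V E) k" "k \<ge> m" for k
  proof -
    let ?u = "\<lambda>E'. shoot V E'"
    have lim: "((\<lambda>E'. ?u E' k * ?u E' (Suc k) - (?u E' k)\<^sup>2) \<longlongrightarrow> ?u E k * ?u E (Suc k) - (?u E k)\<^sup>2) (nhds E)"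
      by (intro tendsto_diff tendsto_mult tendsto_power tendsto_shoot)
    have ev: "\<forall>\<^sub>F E' in nhds E. ?u E' k * ?u E' (Suc k) - (?u E' k)\<^sup>2 > 0"
      using g by (intro order_tendstoD(1)[OF lim]) (simp add: growing_def)
    have "shoot V E k \<noteq> 0" using g by (auto simp: growing_def)
    from ev eventually_crossings_below_eq[OF this] near show ?thesis
    proof eventually_elim
      case (elim E')
      have "crossings (?u E') = crossings_below (?u E') k"
        using elim bnd[OF elim(3)] g(2)
        by (intro crossings_growing) (auto simp: growing_def intro!: less_imp_le)
      moreover have "crossings (?u E) = crossings_below (?u E) k"
        using g bnd[of E] \<delta> by (intro crossings_growing) (auto intro!: less_imp_le)
      ultimately show ?case using elim by simp
    qed
  qed
  have le: "V n \<le> E - (2 + \<delta>)" if "n > m" for n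
    using m[of n] that \<delta> by (simp add: \<delta>_def field_simps)
  show "\<forall>\<^sub>F E' in nhds E. crossings (shoot V E') = crossings (shoot V E)"
    if "\<not> half_eigenvalue V E"
    using not_growing_imp_eigenvalue[of m V E, OF _ \<delta> le] that loc by blast
  show "\<forall>\<^sub>F E' in nhds E. crossings (shoot V E') \<in> {crossings (shoot V E), Suc (crossings (shoot V E))}"
  proof (cases "\<exists>k\<ge>m. growing (shoot V E) k")
    case True
    then obtain k where "k \<ge> m" "growing (shoot V E) k" by blast
    from loc[OF this(2,1)] show ?thesis by eventually_elim auto
  next
    case False
    then have pos: "shoot V E n * shoot V E (Suc n) > 0" if "n \<ge> m" for n
      using not_growing_imp_decaying(1)[of m V E, OF _ \<delta> le that] by blast
    then have eq: "crossings (shoot V E) = crossings_below (shoot V E) m"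
      by (intro crossings_eq_below) (auto simp: crossing_def not_le)
    have "shoot V E m \<noteq> 0" using pos[of m] by auto
    from eventually_crossings_below_eq[OF this] near show ?thesis
    proof eventually_elim
      case (elim E')
      then show ?case using crossings_bounds(2,3)[of m V E'] bnd[OF elim(2)] eq by force
    qed
  qed
qed

text \<open>The count is at least \<open>n\<close> at \<open>E\<close> and 0 at large energies. For
  each \<open>k < n\<close> the last energy at which it drops to \<open>k\<close> or below is an
  eigenvalue with count exactly \<open>k\<close>, so different \<open>k\<close> give different
  eigenvalues.\<close>

lemma eigenvalues_from_crossings:
  assumes V: "V \<longlonglongrightarrow> 0" and E: "E > 2" and n: "n \<le> crossings (shoot V E)"
  shows "\<exists>A. finite A \<and> card A = n \<and> (\<forall>x\<in>A. half_eigenvalue V x \<and> E \<le> x)"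
proof -
  let ?S = "\<lambda>E. crossings (shoot V E)"
  from V have "Bseq V" by (intro convergent_imp_Bseq) (auto simp: convergent_def)
  then obtain M where M: "\<And>n. \<bar>V n\<bar> \<le> M" by (auto simp: Bseq_def)
  have big: "?S x = 0" if "x > M + 2" for x
  proof -
    have "growing (shoot V x) 0" using M[of 0] that by (simp add: growing_def)
    then have "?S x = crossings_below (shoot V x) 0"
      by (rule crossings_growing) (use M that in \<open>smt (verit)\<close>)
    then show ?thesis by (simp add: crossings_below_def)
  qed
  have ex: "\<exists>x\<ge>E. half_eigenvalue V x \<and> ?S x = k" if k: "k < n" for k
  proof -
    define A where "A = {x. x \<ge> E \<and> ?S x > k}"
    have A: "E \<in> A" "bdd_above A"
      using k n big by (auto simp: A_def intro!: bdd_aboveI[of _ "M + 2"]) (metis less_nat_zero_code not_le)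
    define T where "T = Sup A"
    have "T \<ge> E" unfolding T_def using A by (intro cSup_upper)
    with E have "T > 2" by simp
    note near = eventually_crossings_near[OF V this]
    \<comment> \<open>Every neighbourhood of the supremum \<open>T\<close> meets \<open>A\<close>
      and also contains points above \<open>T\<close>, which are outside \<open>A\<close>.\<close>
    have get: "\<exists>a\<in>A. P a" "\<exists>b. b \<notin> A \<and> b \<ge> E \<and> P b" if P: "\<forall>\<^sub>F x in nhds T. P x" for P
    proof -
      from P obtain d where d: "d > 0" "\<And>x. dist x T < d \<Longrightarrow> P x"
        unfolding eventually_nhds_metric by blast
      obtain a where a: "a \<in> A" "T - d < a"
        using less_cSupD[of A "T - d"] A d unfolding T_def by force
      have "a \<le> T" unfolding T_def using a A by (intro cSup_upper)
      then show "\<exists>a\<in>A. P a" using a d by (intro bexI[of _ a]) (auto simp: dist_real_def)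
      have "T + d / 2 \<notin> A" using cSup_upper[OF _ A(2), of "T + d / 2"] d unfolding T_def by auto
      then show "\<exists>b. b \<notin> A \<and> b \<ge> E \<and> P b"
        using d \<open>T \<ge> E\<close> by (intro exI[of _ "T + d / 2"]) (auto simp: dist_real_def)
    qed
    \<comment> \<open>Nearby counts are \<open>?S T\<close> or \<open>?S T + 1\<close>; one of them
      exceeds \<open>k\<close> and one is at most \<open>k\<close>.\<close>
    have "?S T = k" using get[OF near(1)] by (auto simp: A_def)
    moreover have "half_eigenvalue V T"
    proof (rule ccontr)
      assume "\<not> ?thesis"
      from get[OF near(2)[OF this]] show False by (auto simp: A_def)
    qed
    ultimately show ?thesis using \<open>T \<ge> E\<close> by auto
  qed
  then obtain T where T: "\<And>k. k < n \<Longrightarrow> T k \<ge> E \<and> half_eigenvalue V (T k) \<and> ?S (T k) = k"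
    by metis
  then have "inj_on T {..<n}" by (intro inj_onI) (metis lessThan_iff)
  then show ?thesis using T by (intro exI[of _ "T ` {..<n}"]) (auto simp: card_image)
qed

subsection \<open>Each dyadic block of the potential forces a sign change\<close>

text \<open>The sum of \<open>(E' - E) * u n * \<psi> n\<close> telescopes to Wronskian boundary
  terms. As \<open>\<psi>\<close> vanishes at both ends these are nonpositive, whereas the sum is
  positive.\<close>

lemma sturm_comparison:
  assumes "x < y" and \<psi>: "\<psi> x = 0" "\<psi> y = 0" "\<And>n. x < n \<Longrightarrow> n < y \<Longrightarrow> \<psi> n > 0"
    and h\<psi>: "\<And>n. x < n \<Longrightarrow> n < y \<Longrightarrow> half_schr V \<psi> n = E' * \<psi> n"
    and hu: "\<And>n. half_schr V u n = E * u n" and "E < E'"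
    and u: "\<And>n. n \<in> {x..y} \<Longrightarrow> u n \<ge> 0" "x < p" "p < y" "u p \<noteq> 0"
  shows False
proof -
  have tel: "(\<Sum>n = Suc x..<m. (E' - E) * (u n * \<psi> n))
      = u (m - 1) * \<psi> m - u m * \<psi> (m - 1) - u x * \<psi> (Suc x)" if "x < m" "m \<le> y" for m
    using that
  proof (induction m)
    case (Suc m)
    show ?case
    proof (cases "m = x")
      case True
      then show ?thesis using \<psi> by simp
    next
      case False
      then have m: "x < m" "m < y" using Suc.prems by auto
      have "(E' - E) * (u m * \<psi> m) = u m * half_schr V \<psi> m - half_schr V u m * \<psi> m"
        unfolding h\<psi>[OF m] hu by (simp add: algebra_simps)
      also have "\<dots> = u m * \<psi> (Suc m) - u (Suc m) * \<psi> m - (u (m - 1) * \<psi> m - u m * \<psi> (m - 1))"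
        using m by (simp add: half_schr_def algebra_simps)
      finally show ?thesis using Suc.IH m by simp
    qed
  qed simp
  have "(\<Sum>n = Suc x..<y. (E' - E) * (u n * \<psi> n)) \<le> 0"
  proof -
    have "Suc x < y" using \<open>x < p\<close> \<open>p < y\<close> by simp
    then have "\<psi> (y - 1) > 0" "\<psi> (Suc x) > 0" by (auto intro!: \<psi>(3))
    then have "0 \<le> u y * \<psi> (y - 1)" "0 \<le> u x * \<psi> (Suc x)" using u(1) \<open>x < y\<close> by auto
    then show ?thesis using tel[of y] \<open>x < y\<close> \<psi>(2) by simp
  qed
  moreover have "(\<Sum>n = Suc x..<y. (E' - E) * (u n * \<psi> n)) > 0"
  proof (rule sum_pos2[of _ p])
    have "u p > 0" using u by (simp add: order_less_le)
    then show "0 < (E' - E) * (u p * \<psi> p)" using u \<psi>(3) \<open>E < E'\<close> by simp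
    show "0 \<le> (E' - E) * (u n * \<psi> n)" if "n \<in> {Suc x..<y}" for n
      using that u(1)[of n] \<psi>(3)[of n] \<open>E < E'\<close> by (intro mult_nonneg_nonneg) auto
  qed (use u in auto)
  ultimately show False by linarith
qed

lemma no_crossing_imp_constant_sign:
  assumes "\<And>n. x \<le> n \<Longrightarrow> n < y \<Longrightarrow> \<not> crossing u n" "u x \<noteq> 0" "n \<in> {x..y}"
  shows "u x * u n > 0"
proof -
  have "x \<le> n" "n \<le> y" using assms(3) by auto
  then show ?thesis
  proof (induction n rule: dec_induct)
    case (step n)
    then have "u x * u n > 0" "\<not> crossing u n" using assms(1) by auto
    then show ?case by (auto simp: crossing_def zero_less_mult_iff mult_le_0_iff not_le)
  qed (use assms(2) in \<open>auto simp: zero_less_mult_iff\<close>)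
qed

text \<open>Without a crossing the solution would keep one sign on the block, against Sturm
  comparison with \<open>\<psi>\<close>.\<close>

lemma crossing_in_block:
  assumes "Suc (Suc x) < y" and \<psi>: "\<psi> x = 0" "\<psi> y = 0" "\<And>n. x < n \<Longrightarrow> n < y \<Longrightarrow> \<psi> n > 0"
    and h\<psi>: "\<And>n. x < n \<Longrightarrow> n < y \<Longrightarrow> half_schr V \<psi> n = E' * \<psi> n"
    and "E < E'"
  shows "\<exists>n\<in>{x..<y}. crossing (shoot V E) n"
proof (rule ccontr)
  assume none: "\<not> ?thesis"
  let ?u = "shoot V E"
  have same: "?u x' * ?u n > 0" if "x \<le> x'" "?u x' \<noteq> 0" "n \<in> {x'..y}" for x' n
    using none that by (intro no_crossing_imp_constant_sign[of x' y]) auto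
  \<comment> \<open>A zero at \<open>x\<close> itself is not counted as a crossing there, so the
    sign is read off at the first nonzero site; multiplying by that value makes the solution
    nonnegative.\<close>
  obtain x' where x': "x \<le> x'" "x' \<le> Suc x" "?u x' \<noteq> 0" "x' = Suc x \<Longrightarrow> ?u x = 0"
  proof (cases "?u x = 0")
    case True
    then show ?thesis using shoot_consecutive[of V E x] by (intro that[of "Suc x"]) auto
  qed (intro that[of x], auto)
  define u where "u n = ?u x' * ?u n" for n
  show False
  proof (rule sturm_comparison[of x y \<psi> V E' u E "Suc (Suc x)"])
    show "half_schr V u n = E * u n" for n
    proof -
      have "half_schr V u n = ?u x' * half_schr V ?u n"
        by (simp add: half_schr_def u_def algebra_simps)
      then show ?thesis by (simp add: half_schr_shoot u_def)
    qed
    have pos: "u n > 0" if "n \<in> {x'..y}" for n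
      using same[OF x'(1,3) that] by (simp add: u_def)
    show "u n \<ge> 0" if "n \<in> {x..y}" for n
    proof (cases "n < x'")
      case True
      then have "n = x" "x' = Suc x" using that x' by auto
      then show ?thesis using x'(4) by (simp add: u_def)
    qed (use pos[of n] that in auto)
    show "u (Suc (Suc x)) \<noteq> 0" using pos[of "Suc (Suc x)"] x' assms(1) by auto
  qed (use assms in auto)
qed

text \<open>On a stretch where \<open>V n = (-1)^n w\<close>, the sine profile with different amplitudes on even
  and odd sites is an exact solution at energy \<open>sqrt (w^2 + 4 (cos \<kappa>)^2)\<close>.\<close>

lemma alternating_block_solution:
  assumes k: "k \<ge> 2"
  defines "L \<equiv> (2::nat) ^ k"
  obtains \<psi> E' where "\<psi> L = 0" "\<psi> (2 * L) = 0" "\<And>n. L < n \<Longrightarrow> n < 2 * L \<Longrightarrow> \<psi> n > 0"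
    "\<And>n. L < n \<Longrightarrow> n < 2 * L \<Longrightarrow> half_schr pot \<psi> n = E' * \<psi> n" "E' > 2 + 1 / 4 ^ k"
proof -
  have "(2::nat) ^ 2 \<le> L" unfolding L_def using k by (intro power_increasing) auto
  then have L4: "real L \<ge> 4" by simp
  \<comment> \<open>Exactly half a period of the sine fits into the block.\<close>
  define \<kappa> where "\<kappa> = pi / real L"
  have "0 < \<kappa>" using L4 by (simp add: \<kappa>_def)
  have "\<kappa> < pi / 2" using L4 by (simp add: \<kappa>_def field_simps)
  define t where "t = 16 / real L"
  define w where "w = t + t / (1 + t)"
  have t: "0 < t" "t \<le> w" using L4 by (auto simp: t_def w_def)
  define r where "r = 2 * cos \<kappa>"
  have "r > 0" unfolding r_def using \<open>0 < \<kappa>\<close> \<open>\<kappa> < pi / 2\<close> by (simp add: cos_gt_zero)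
  define E' where "E' = sqrt (w\<^sup>2 + r\<^sup>2)"
  have E2: "E' * E' = w * w + r * r"
    unfolding E'_def by (simp add: power2_eq_square)
  have "w < E'" unfolding E'_def using t \<open>r > 0\<close> by (intro real_less_rsqrt) auto
  \<comment> \<open>The amplitudes on even and odd sites form an eigenvector of the symmetric matrix
    with rows \<open>(w, r)\<close> and \<open>(r, - w)\<close>, whose positive eigenvalue is
    \<open>E'\<close>.\<close>
  define c where "c n = (if even n then r else E' - w)" for n :: nat
  have c_pos: "c n > 0" for n using \<open>r > 0\<close> \<open>w < E'\<close> by (simp add: c_def)
  have c_eq: "r * c (Suc n) + (- 1) ^ n * w * c n = E' * c n" for n
    using E2 by (auto simp: c_def algebra_simps)
  define s where "s n = sin (\<kappa> * (real n - real L))" for n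
  have s_eq: "s (Suc n) + s (n - 1) = r * s n" if "n > 0" for n
  proof -
    have "s (Suc n) = sin (\<kappa> * (real n - real L) + \<kappa>)" "s (n - 1) = sin (\<kappa> * (real n - real L) - \<kappa>)"
      using that by (simp_all add: s_def of_nat_diff algebra_simps)
    then show ?thesis by (simp add: sin_add sin_diff r_def s_def)
  qed
  define \<psi> where "\<psi> n = c n * s n" for n
  show thesis
  proof
    show "\<psi> L = 0" by (simp add: \<psi>_def s_def)
    have "\<kappa> * (real (2 * L) - real L) = pi" using L4 by (simp add: \<kappa>_def)
    then show "\<psi> (2 * L) = 0" by (simp add: \<psi>_def s_def)
    fix n assume n: "L < n" "n < 2 * L"
    have "\<kappa> * (real n - real L) < \<kappa> * real L" using n \<open>\<kappa> > 0\<close> by (intro mult_strict_left_mono) auto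
    also have "\<dots> = pi" using L4 by (simp add: \<kappa>_def)
    finally have "s n > 0" unfolding s_def using n \<open>\<kappa> > 0\<close> by (intro sin_gt_zero mult_pos_pos) auto
    then show "\<psi> n > 0" using c_pos by (simp add: \<psi>_def)
    have "amp n = t" "amp (n - 1) = t"
      using n by (auto simp: t_def L_def intro!: amp_dyadic)
    then have pot: "pot n = (- 1) ^ n * w" using n by (simp add: pot_def w_def)
    have "c (n - 1) = c (Suc n)" using n by (cases n) (auto simp: c_def)
    then have "half_schr pot \<psi> n = c (Suc n) * (s (Suc n) + s (n - 1)) + (- 1) ^ n * w * c n * s n"
      using n by (simp add: half_schr_def \<psi>_def pot algebra_simps)
    also have "\<dots> = (r * c (Suc n) + (- 1) ^ n * w * c n) * s n"
      using n by (subst s_eq) (simp_all add: algebra_simps)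
    finally show "half_schr pot \<psi> n = E' * \<psi> n" unfolding c_eq by (simp add: \<psi>_def)
  next
    \<comment> \<open>The cosine costs at most \<open>64 / L^2\<close> in \<open>E'^2\<close>, while
      the amplitude 16 contributes at least \<open>256 / L^2\<close>; the surplus
      \<open>192 / L^2\<close> pushes \<open>E'\<close> above \<open>2 + 1 / L^2\<close>.\<close>
    have "\<bar>sin \<kappa>\<bar> \<le> 4 / real L"
    proof -
      have "\<bar>sin \<kappa>\<bar> \<le> \<bar>\<kappa>\<bar>" by (rule abs_sin_x_le_abs_x)
      also have "\<dots> \<le> 4 / real L" using pi_less_4 by (simp add: \<kappa>_def divide_right_mono)
      finally show ?thesis .
    qed
    then have "(sin \<kappa>)\<^sup>2 \<le> (4 / real L)\<^sup>2"
      using power_mono[of "\<bar>sin \<kappa>\<bar>" "4 / real L" 2] by simp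
    moreover have "r\<^sup>2 = 4 - 4 * (sin \<kappa>)\<^sup>2" by (simp add: r_def power_mult_distrib cos_squared_eq)
    moreover have "t\<^sup>2 \<le> w\<^sup>2" using t by (intro power_mono) auto
    ultimately have "w\<^sup>2 + r\<^sup>2 \<ge> 4 + (16 / real L)\<^sup>2 - 4 * (4 / real L)\<^sup>2"
      unfolding t_def by linarith
    also have "4 + (16 / real L)\<^sup>2 - 4 * (4 / real L)\<^sup>2 = 4 + 192 * (1 / real L)\<^sup>2"
      by (simp add: power_divide)
    finally have ge: "4 + 192 * (1 / real L)\<^sup>2 \<le> w\<^sup>2 + r\<^sup>2" .
    define q where "q = (1 / real L)\<^sup>2"
    have q: "0 < q" "q \<le> 1" using L4 by (auto simp: q_def power_divide divide_le_eq_1)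
    have "q\<^sup>2 \<le> q" using q by (simp add: power2_eq_square mult_left_le)
    then have "(2 + q)\<^sup>2 < 4 + 192 * q" using q by (simp add: power2_sum)
    then have "2 + q < E'" unfolding E'_def using ge by (intro real_less_rsqrt) (simp add: q_def)
    moreover have "q = 1 / 4 ^ k"
      by (simp add: q_def L_def power2_eq_square flip: power_mult_distrib)
    ultimately show "E' > 2 + 1 / 4 ^ k" by simp
  qed
qed

text \<open>The \<open>n\<close> disjoint blocks with \<open>k\<close> from 2 to
  \<open>n + 1\<close> give one crossing each. The last block has the lowest guaranteed energy and
  sets the threshold.\<close>

lemma pot_crossings_ge: "n \<le> crossings (shoot pot (2 + 1 / 4 ^ Suc n))"
proof -
  let ?u = "shoot pot (2 + 1 / 4 ^ Suc n)"
  have "\<exists>i\<in>{2 ^ k..<2 * 2 ^ k}. crossing ?u i" if k: "k \<in> {2..Suc n}" for k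
  proof -
    obtain \<psi> E' where \<psi>: "\<psi> (2 ^ k) = 0" "\<psi> (2 * 2 ^ k) = 0"
      "\<And>n. 2 ^ k < n \<Longrightarrow> n < 2 * 2 ^ k \<Longrightarrow> \<psi> n > 0"
      "\<And>n. 2 ^ k < n \<Longrightarrow> n < 2 * 2 ^ k \<Longrightarrow> half_schr pot \<psi> n = E' * \<psi> n" "E' > 2 + 1 / 4 ^ k"
      using alternating_block_solution[of k] k by (metis atLeastAtMost_iff)
    have "(1::real) / 4 ^ Suc n \<le> 1 / 4 ^ k"
      using k by (intro divide_left_mono power_increasing) auto
    then have "2 + 1 / 4 ^ Suc n < E'" using \<psi>(5) by linarith
    moreover have "(2::nat) ^ 2 \<le> 2 ^ k" using k by (intro power_increasing) auto
    then have "Suc (Suc (2 ^ k)) < 2 * 2 ^ k" by simp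
    ultimately show ?thesis using \<psi> by (intro crossing_in_block[where \<psi> = \<psi> and E' = E']) auto
  qed
  then obtain p where p: "\<And>k. k \<in> {2..Suc n} \<Longrightarrow> 2 ^ k \<le> p k \<and> p k < 2 ^ Suc k \<and> crossing ?u (p k)"
    by (metis atLeastLessThan_iff power_Suc)
  have "p i < p j" if "i \<in> {2..Suc n}" "j \<in> {2..Suc n}" "i < j" for i j
  proof -
    have "(2::nat) ^ Suc i \<le> 2 ^ j" using that by (intro power_increasing) auto
    then show ?thesis using p[OF that(1)] p[OF that(2)] by linarith
  qed
  then have "inj_on p {2..Suc n}" by (intro linorder_inj_onI) (metis less_irrefl, auto)
  \<comment> \<open>Finiteness of the set of crossings has to be secured because \<open>card\<close>
    of an infinite set is 0.\<close>
  moreover obtain m where "\<And>k. k > m \<Longrightarrow> pot k < 2 + 1 / 4 ^ Suc n - 2"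
  proof -
    have "\<forall>\<^sub>F k in sequentially. pot k < 2 + 1 / 4 ^ Suc n - 2"
      using pot_tendsto_0 by (intro order_tendstoD(2)) auto
    then show ?thesis using that unfolding eventually_sequentially by (metis less_imp_le)
  qed
  from crossings_bounds(1)[OF this] have "finite {i. crossing ?u i}" .
  moreover have "p ` {2..Suc n} \<subseteq> {i. crossing ?u i}" using p by auto
  ultimately have "card {2..Suc n} \<le> card {i. crossing ?u i}" by (intro card_inj_on_le)
  then show ?thesis by (simp add: crossings_def)
qed

subsection \<open>An upper bound on the number of eigenvalues\<close>

text \<open>A homogeneous system with more unknowns than equations has a nontrivial solution.
  Gaussian elimination: subtracting multiples of a pivot row \<open>p\<close> clears column
  \<open>j\<close>, and the coefficient of \<open>p\<close> is restored afterwards.\<close>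

lemma exists_annihilating_combination:
  fixes v :: "'a \<Rightarrow> 'b \<Rightarrow> real"
  assumes "finite J" "finite I" "card J < card I"
  shows "\<exists>c. (\<exists>i\<in>I. c i \<noteq> 0) \<and> (\<forall>j\<in>J. (\<Sum>i\<in>I. c i * v i j) = 0)"
  using assms
proof (induction J arbitrary: I v rule: finite_induct)
  case empty
  then have "I \<noteq> {}" by auto
  then show ?case by (intro exI[of _ "\<lambda>_. 1"]) auto
next
  case (insert j J)
  show ?case
  proof (cases "\<forall>i\<in>I. v i j = 0")
    case True
    moreover obtain c where "\<exists>i\<in>I. c i \<noteq> 0" "\<forall>j\<in>J. (\<Sum>i\<in>I. c i * v i j) = 0"
      using insert.IH[of I v] insert.hyps insert.prems by (metis card_insert_disjoint less_Suc_eq not_less_eq Suc_lessD)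
    ultimately show ?thesis by (intro exI[of _ c]) auto
  next
    case False
    then obtain p where p: "p \<in> I" "v p j \<noteq> 0" by blast
    define I' where "I' = I - {p}"
    have I': "finite I'" "card J < card I'" "p \<notin> I'" "I = insert p I'"
      using insert p by (auto simp: I'_def card_Diff_singleton)
    define v' where "v' i l = v i l - v i j / v p j * v p l" for i l
    obtain c where c: "\<exists>i\<in>I'. c i \<noteq> 0" "\<And>l. l \<in> J \<Longrightarrow> (\<Sum>i\<in>I'. c i * v' i l) = 0"
      using insert.IH[OF I'(1,2), of v'] by auto
    define d where "d i = (if i = p then - (\<Sum>i\<in>I'. c i * v i j) / v p j else c i)" for i
    have sum: "(\<Sum>i\<in>I. d i * v i l) = (\<Sum>i\<in>I'. c i * v' i l)" for l
    proof -
      have "(\<Sum>i\<in>I. d i * v i l) = d p * v p l + (\<Sum>i\<in>I'. c i * v i l)"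
        using I' by (auto simp: d_def intro!: sum.cong)
      also have "d p * v p l = - (\<Sum>i\<in>I'. c i * (v i j / v p j * v p l))"
        by (simp add: d_def sum_distrib_left sum_distrib_right sum_divide_distrib mult_ac)
      finally show ?thesis by (simp add: v'_def sum_subtractf algebra_simps)
    qed
    have "v' i j = 0" for i using p by (simp add: v'_def)
    then have "\<forall>l\<in>insert j J. (\<Sum>i\<in>I. d i * v i l) = 0" using c(2) by (simp add: sum)
    moreover have "\<exists>i\<in>I. d i \<noteq> 0" using c(1) I'(3,4) by (auto simp: d_def)
    ultimately show ?thesis by blast
  qed
qed

section \<open>Orthogonality of eigenfunctions\<close>

lemma l2_seq_tendsto_0: "l2_seq f \<Longrightarrow> f \<longlonglongrightarrow> 0"
  unfolding l2_seq_def using summable_LIMSEQ_zero[of "\<lambda>n. (f n)\<^sup>2"]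
    tendsto_real_sqrt[of "\<lambda>n. (f n)\<^sup>2" 0 sequentially] by (simp add: tendsto_rabs_zero_iff)

lemma l2_seq_mult_summable:
  assumes "l2_seq f" "l2_seq g"
  shows "summable (\<lambda>n. f n * g n)"
proof (rule summable_comparison_test')
  show "summable (\<lambda>n. (f n)\<^sup>2 + (g n)\<^sup>2)"
    using assms unfolding l2_seq_def by (rule summable_add)
  fix n
  have "2 * (\<bar>f n\<bar> * \<bar>g n\<bar>) \<le> (f n)\<^sup>2 + (g n)\<^sup>2"
    using sum_squares_bound[of "\<bar>f n\<bar>" "\<bar>g n\<bar>"] by simp
  moreover have "0 \<le> \<bar>f n\<bar> * \<bar>g n\<bar>" by simp
  ultimately show "norm (f n * g n) \<le> (f n)\<^sup>2 + (g n)\<^sup>2"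
    unfolding real_norm_def abs_mult by linarith
qed

text \<open>By summation by parts, \<open>E - E'\<close> times the partial inner product is a
  Wronskian boundary term, which tends to 0.\<close>

lemma eigenfunctions_orthogonal:
  assumes "l2_seq f" "l2_seq g"
    and f: "\<And>n. half_schr V f n = E * f n" and g: "\<And>n. half_schr V g n = E' * g n"
    and "E \<noteq> E'"
  shows "(\<Sum>n. f n * g n) = 0"
proof -
  have "(E - E') * (\<Sum>n<N. f n * g n) = (if N = 0 then 0 else f N * g (N - 1) - f (N - 1) * g N)" for N
  proof (induction N)
    case (Suc N)
    have "E * f N * g N - E' * g N * f N = half_schr V f N * g N - half_schr V g N * f N"
      by (simp add: f g)
    with Suc show ?case by (auto simp: half_schr_def algebra_simps)
  qed simp
  then have eq: "(E - E') * (\<Sum>n<Suc N. f n * g n) = f (Suc N) * g N - f N * g (Suc N)" for N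
    by (metis Suc_neq_Zero diff_Suc_1)
  have lim: "f \<longlonglongrightarrow> 0" "g \<longlonglongrightarrow> 0" using assms by (auto intro: l2_seq_tendsto_0)
  have "(\<lambda>N. f (Suc N) * g N - f N * g (Suc N)) \<longlonglongrightarrow> 0 * 0 - 0 * 0"
    by (intro tendsto_intros LIMSEQ_Suc lim)
  moreover have "(\<lambda>N. (E - E') * (\<Sum>n<Suc N. f n * g n)) \<longlonglongrightarrow> (E - E') * (\<Sum>n. f n * g n)"
    by (intro tendsto_intros LIMSEQ_Suc[OF summable_LIMSEQ] l2_seq_mult_summable assms)
  ultimately have "(E - E') * (\<Sum>n. f n * g n) = 0"
    unfolding eq using LIMSEQ_unique by fastforce
  then show ?thesis using \<open>E \<noteq> E'\<close> by simp
qed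

text \<open>Young's inequality spends half of the kinetic energy on the potential term. The zero at
  \<open>x\<close> gives a Poincare bound \<open>\<psi>^2 \<le> L * D\<close> by Cauchy-Schwarz, so
  on a short block the remaining half absorbs the rest. For \<open>L = 1\<close> all terms
  vanish.\<close>

lemma block_sum_bound:
  fixes \<psi> F :: "nat \<Rightarrow> real"
  assumes "\<psi> x = 0" and "\<psi> (x + L) = 0" and "A \<ge> 0"
    and F: "\<And>n. \<bar>F (Suc n)\<bar> \<le> A / real (Suc n)"
    and L: "L = 1 \<or> 2 * A * real L \<le> real (Suc x)"
  shows "(\<Sum>n = x..<x + L. F (Suc n) * ((\<psi> n)\<^sup>2 - (\<psi> (Suc n))\<^sup>2) - (\<psi> (Suc n) - \<psi> n)\<^sup>2) \<le> 0"
proof (cases "L = 1")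
  case True
  then show ?thesis using assms by simp
next
  case False
  define d where "d n = \<psi> (Suc n) - \<psi> n" for n
  define D where "D = (\<Sum>n = x..<x + L. (d n)\<^sup>2)"
  define B where "B = (A / real (Suc x))\<^sup>2"
  have sq: "(\<psi> n)\<^sup>2 \<le> real L * D" if n: "n \<in> {x..x + L}" for n
  proof -
    have "\<psi> n = (\<Sum>j = x..<n. d j)"
      using n assms(1) sum_Suc_diff'[of x n \<psi>] by (simp add: d_def)
    then have "(\<psi> n)\<^sup>2 \<le> real (n - x) * (\<Sum>j = x..<n. (d j)\<^sup>2)"
      using sum_squared_le_sum_of_squares[of "d" "{x..<n}"] by (simp add: mult.commute)
    also have "\<dots> \<le> real L * D"
      unfolding D_def using n by (intro mult_mono sum_mono2 sum_nonneg) auto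
    finally show ?thesis .
  qed
  have term_le: "F (Suc n) * ((\<psi> n)\<^sup>2 - (\<psi> (Suc n))\<^sup>2) - (d n)\<^sup>2 \<le> 2 * B * (real L * D) - (d n)\<^sup>2 / 2"
    if n: "n \<in> {x..<x + L}" for n
  proof -
    define s where "s = \<psi> n + \<psi> (Suc n)"
    have "0 \<le> (F (Suc n) * s + d n)\<^sup>2" by simp
    then have "- 2 * (F (Suc n) * s * d n) \<le> (F (Suc n))\<^sup>2 * s\<^sup>2 + (d n)\<^sup>2"
      by (simp add: power2_sum power_mult_distrib)
    moreover have "F (Suc n) * ((\<psi> n)\<^sup>2 - (\<psi> (Suc n))\<^sup>2) = - (F (Suc n) * s * d n)"
      by (simp add: s_def d_def power2_eq_square algebra_simps)
    moreover have "(F (Suc n))\<^sup>2 * s\<^sup>2 \<le> B * (4 * (real L * D))"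
    proof (rule mult_mono)
      have "\<bar>F (Suc n)\<bar> \<le> A / real (Suc x)"
        using F[of n] n \<open>A \<ge> 0\<close> by (intro order_trans[OF F] divide_left_mono) auto
      then show "(F (Suc n))\<^sup>2 \<le> B" unfolding B_def using abs_le_square_iff \<open>A \<ge> 0\<close> by fastforce
      have "s\<^sup>2 \<le> 2 * ((\<psi> n)\<^sup>2 + (\<psi> (Suc n))\<^sup>2)"
        using sum_squares_bound[of "\<psi> n" "\<psi> (Suc n)"] by (simp add: s_def power2_sum)
      then show "s\<^sup>2 \<le> 4 * (real L * D)" using sq[of n] sq[of "Suc n"] n by auto
    qed (auto simp: B_def)
    ultimately show ?thesis by linarith
  qed
  have "(\<Sum>n = x..<x + L. F (Suc n) * ((\<psi> n)\<^sup>2 - (\<psi> (Suc n))\<^sup>2) - (d n)\<^sup>2)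
      \<le> (\<Sum>n = x..<x + L. 2 * B * (real L * D) - (d n)\<^sup>2 / 2)"
    by (intro sum_mono term_le)
  also have "\<dots> = 2 * (B * (real L)\<^sup>2) * D - D / 2"
    by (simp add: D_def sum_subtractf sum_divide_distrib power2_eq_square mult_ac)
  also have "\<dots> \<le> 2 * (1 / 4) * D - D / 2"
  proof -
    \<comment> \<open>This smallness of the block relative to its position makes the potential part
      at most \<open>D / 2\<close>.\<close>
    have "A / real (Suc x) * real L \<le> 1 / 2" using L False by (simp add: field_simps)
    then have "(A / real (Suc x) * real L)\<^sup>2 \<le> (1 / 2)\<^sup>2"
      using \<open>A \<ge> 0\<close> by (intro power_mono) auto
    then have "B * (real L)\<^sup>2 \<le> 1 / 4" by (simp add: B_def flip: power_mult_distrib) (simp add: power2_eq_square)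
    moreover have "D \<ge> 0" unfolding D_def by (intro sum_nonneg) auto
    ultimately show ?thesis by (intro diff_right_mono mult_right_mono) auto
  qed
  finally show ?thesis by (simp add: d_def)
qed

text \<open>Dirichlet conditions are imposed at these sites. Consecutive gaps are either 1 or at most
  \<open>2 x / J\<close>, while only logarithmically many sites lie below a given bound.\<close>

fun grid :: "nat \<Rightarrow> nat \<Rightarrow> nat" where
  "grid J 0 = 0"
| "grid J (Suc k) = grid J k + (grid J k div J + 1)"

text \<open>As \<open>x div J + 1 \<ge> (x + 1) / J\<close>, each step multiplies
  \<open>x + 1\<close> by at least \<open>1 + 1 / J\<close>.\<close>

lemma grid_lower:
  assumes "J > 0"
  shows "(1 + 1 / real J) ^ k \<le> real (Suc (grid J k))"
proof (induction k)
  case (Suc k)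
  define x where "x = grid J k"
  have "x < J * (x div J + 1)" using dividend_less_times_div[of J x] assms by simp
  then have "Suc x \<le> J * (x div J + 1)" by simp
  then have "real (Suc x) \<le> real J * real (x div J + 1)" by (metis of_nat_le_iff of_nat_mult)
  then have *: "real (Suc x) / real J \<le> real (x div J + 1)"
    using assms by (simp add: field_simps)
  have "(1 + 1 / real J) ^ Suc k \<le> (1 + 1 / real J) * real (Suc x)"
    using Suc.IH assms by (simp add: x_def mult_left_mono)
  also have "\<dots> = real (Suc x) + real (Suc x) / real J" by (simp add: algebra_simps add_divide_distrib)
  also have "\<dots> \<le> real (Suc x) + real (x div J + 1)" using * by simp
  also have "\<dots> = real (Suc (grid J (Suc k)))" by (simp add: x_def)
  finally show ?case .
qed simp

text \<open>Below \<open>J\<close> the gaps are 1. From \<open>J\<close> on,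
  \<open>J * L \<le> 2 * x\<close>, so \<open>4 * A \<le> J\<close> yields the smallness that
  \<open>block_sum_bound\<close> asks for.\<close>

lemma grid_sum_bound:
  assumes "\<And>j. j \<le> K \<Longrightarrow> \<psi> (grid J j) = 0"
    and "A > 0" "4 * A \<le> real J" and F: "\<And>n. \<bar>F (Suc n)\<bar> \<le> A / real (Suc n)"
  shows "(\<Sum>n<grid J K. F (Suc n) * ((\<psi> n)\<^sup>2 - (\<psi> (Suc n))\<^sup>2) - (\<psi> (Suc n) - \<psi> n)\<^sup>2) \<le> 0"
    (is "(\<Sum>n<_. ?f n) \<le> 0")
  using assms(1)
proof (induction K)
  case (Suc K)
  define x where "x = grid J K"
  define L where "L = x div J + 1"
  have J: "real J > 0" using assms by linarith
  have "L = 1 \<or> 2 * A * real L \<le> real (Suc x)"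
  proof (cases "x < J")
    case False
    have "2 * A * real L \<le> real J / 2 * real L" using assms by (intro mult_right_mono) auto
    also have "\<dots> = real (J * (x div J) + J) / 2" by (simp add: L_def algebra_simps)
    also have "\<dots> \<le> real (2 * x) / 2"
    proof (intro divide_right_mono)
      have "J * (x div J) + J \<le> 2 * x"
        using False times_div_less_eq_dividend[of J x] by linarith
      then show "real (J * (x div J) + J) \<le> real (2 * x)" by (simp only: of_nat_le_iff)
    qed simp
    finally show ?thesis by simp
  qed (auto simp: L_def)
  moreover have "\<psi> x = 0" "\<psi> (x + L) = 0"
    using Suc.prems[of K] Suc.prems[of "Suc K"] by (auto simp: x_def L_def)
  ultimately have "(\<Sum>n = x..<x + L. ?f n) \<le> 0"
    using assms by (intro block_sum_bound[where A = A]) auto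
  moreover have "(\<Sum>n<x. ?f n) \<le> 0" unfolding x_def by (intro Suc.IH Suc.prems) auto
  moreover have "(\<Sum>n<x + L. ?f n) = (\<Sum>n<x. ?f n) + (\<Sum>n = x..<x + L. ?f n)"
    using sum.atLeastLessThan_concat[of 0 x "x + L" ?f] by (simp add: atLeast0LessThan)
  moreover have "grid J (Suc K) = x + L" by (simp add: x_def L_def)
  ultimately show ?case by (simp only:)
qed simp

text \<open>Summation by parts moves the difference from \<open>F\<close> to \<open>\<psi>^2\<close>
  and turns the hopping terms minus 2 into minus the kinetic energy, up to boundary terms at
  \<open>N\<close>.\<close>

lemma quadratic_form_eq:
  assumes V: "\<And>n. V n = F (Suc n) - F n" and "\<psi> 0 = 0"
  shows "(\<Sum>n<Suc N. \<psi> n * (half_schr V \<psi> n - 2 * \<psi> n)) =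
    \<psi> N * (\<psi> (Suc N) - \<psi> N) + F (Suc N) * (\<psi> N)\<^sup>2 +
    (\<Sum>n<N. F (Suc n) * ((\<psi> n)\<^sup>2 - (\<psi> (Suc n))\<^sup>2) - (\<psi> (Suc n) - \<psi> n)\<^sup>2)"
proof (induction N)
  case 0
  then show ?case using assms by simp
next
  case (Suc N)
  then show ?case
    by (subst sum.lessThan_Suc, subst Suc.IH)
       (simp add: half_schr_def V algebra_simps power2_eq_square)
qed

text \<open>Completing the square. It serves past the last grid site, where no zeros of
  \<open>\<psi>\<close> are available.\<close>

lemma tail_term_bound:
  fixes a b f :: real
  assumes "\<bar>f\<bar> \<le> B"
  shows "f * (a\<^sup>2 - b\<^sup>2) - (b - a)\<^sup>2 \<le> B\<^sup>2 * (a\<^sup>2 + b\<^sup>2)"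
proof -
  define s where "s = a + b"
  define d where "d = b - a"
  have "f * (a\<^sup>2 - b\<^sup>2) = - (f * s * d)"
    by (simp add: s_def d_def power2_eq_square algebra_simps)
  moreover have "0 \<le> (f * s / 2 + d)\<^sup>2" by simp
  then have "0 \<le> f\<^sup>2 * (s\<^sup>2 / 4) + f * s * d + d\<^sup>2"
    by (simp add: power2_sum power_mult_distrib power_divide)
  ultimately have "f * (a\<^sup>2 - b\<^sup>2) - (b - a)\<^sup>2 \<le> f\<^sup>2 * ((a + b)\<^sup>2 / 4)"
    unfolding s_def d_def by linarith
  also have "\<dots> \<le> B\<^sup>2 * (a\<^sup>2 + b\<^sup>2)"
  proof (rule mult_mono)
    show "f\<^sup>2 \<le> B\<^sup>2" using assms power_mono[of "\<bar>f\<bar>" B 2] by simp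
    have "(a + b)\<^sup>2 \<le> 2 * (a\<^sup>2 + b\<^sup>2)"
      using sum_squares_bound[of a b] by (simp add: power2_sum)
    also have "\<dots> \<le> (a\<^sup>2 + b\<^sup>2) * 4" by simp
    finally show "(a + b)\<^sup>2 / 4 \<le> a\<^sup>2 + b\<^sup>2" by simp
  qed auto
  finally show ?thesis .
qed

text \<open>The grid part is nonpositive, the tail costs \<open>2 * B^2\<close> times the squared
  norm with \<open>B = A / (x + 1)\<close>, and the boundary terms vanish in the limit.\<close>

lemma quadratic_form_le:
  assumes V: "\<And>n. V n = F (Suc n) - F n" and F: "\<And>n. \<bar>F (Suc n)\<bar> \<le> A / real (Suc n)"
    and A: "A > 0" "4 * A \<le> real J"
    and \<psi>: "l2_seq \<psi>" "\<And>j. j \<le> K \<Longrightarrow> \<psi> (grid J j) = 0"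
    and h: "summable (\<lambda>n. \<psi> n * half_schr V \<psi> n)"
  shows "(\<Sum>n. \<psi> n * half_schr V \<psi> n)
    \<le> (2 + 2 * A\<^sup>2 / (real (Suc (grid J K)))\<^sup>2) * (\<Sum>n. (\<psi> n)\<^sup>2)"
proof -
  define x where "x = grid J K"
  define B where "B = A / real (Suc x)"
  let ?f = "\<lambda>n. F (Suc n) * ((\<psi> n)\<^sup>2 - (\<psi> (Suc n))\<^sup>2) - (\<psi> (Suc n) - \<psi> n)\<^sup>2"
  have sm: "summable (\<lambda>n. (\<psi> n)\<^sup>2)" using \<psi>(1) by (simp add: l2_seq_def)
  have FB: "\<bar>F (Suc n)\<bar> \<le> B" if "n \<ge> x" for n
    unfolding B_def using that A by (intro order_trans[OF F] divide_left_mono) auto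
  have tail: "(\<Sum>n = x..<N. ?f n) \<le> 2 * B\<^sup>2 * (\<Sum>n<Suc N. (\<psi> n)\<^sup>2)" for N
  proof -
    have "(\<Sum>n = x..<N. ?f n) \<le> (\<Sum>n = x..<N. B\<^sup>2 * ((\<psi> n)\<^sup>2 + (\<psi> (Suc n))\<^sup>2))"
      by (intro sum_mono tail_term_bound FB) auto
    also have "\<dots> \<le> (\<Sum>n<N. B\<^sup>2 * ((\<psi> n)\<^sup>2 + (\<psi> (Suc n))\<^sup>2))"
      by (intro sum_mono2) auto
    also have "\<dots> = B\<^sup>2 * ((\<Sum>n<N. (\<psi> n)\<^sup>2) + (\<Sum>n<N. (\<psi> (Suc n))\<^sup>2))"
      by (simp add: sum.distrib flip: sum_distrib_left)
    also have "\<dots> \<le> B\<^sup>2 * ((\<Sum>n<Suc N. (\<psi> n)\<^sup>2) + (\<Sum>n<Suc N. (\<psi> n)\<^sup>2))"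
    proof (intro mult_left_mono add_mono)
      show "(\<Sum>n<N. (\<psi> (Suc n))\<^sup>2) \<le> (\<Sum>n<Suc N. (\<psi> n)\<^sup>2)"
        by (subst sum.lessThan_Suc_shift) simp
    qed simp_all
    finally show ?thesis by (simp add: algebra_simps)
  qed
  have le: "(\<Sum>n<Suc N. \<psi> n * (half_schr V \<psi> n - 2 * \<psi> n)) - 2 * B\<^sup>2 * (\<Sum>n<Suc N. (\<psi> n)\<^sup>2)
      \<le> \<psi> N * (\<psi> (Suc N) - \<psi> N) + A * (\<psi> N)\<^sup>2" if "N \<ge> x" for N
  proof -
    have "(\<Sum>n<N. ?f n) = (\<Sum>n<x. ?f n) + (\<Sum>n = x..<N. ?f n)"
      using sum.atLeastLessThan_concat[of 0 x N ?f] that by (simp add: atLeast0LessThan)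
    moreover have "(\<Sum>n<x. ?f n) \<le> 0"
      unfolding x_def by (intro grid_sum_bound[where A = A] \<psi> A F)
    moreover have "F (Suc N) * (\<psi> N)\<^sup>2 \<le> A * (\<psi> N)\<^sup>2"
    proof (intro mult_right_mono)
      have "A / real (Suc N) \<le> A / 1" using A by (intro divide_left_mono) auto
      then show "F (Suc N) \<le> A" using F[of N] by linarith
    qed simp
    moreover have "\<psi> 0 = 0" using \<psi>(2)[of 0] by simp
    ultimately show ?thesis using tail[of N] quadratic_form_eq[of V F \<psi> N, OF V] by linarith
  qed
  have lim: "\<psi> \<longlonglongrightarrow> 0" using \<psi> by (intro l2_seq_tendsto_0)
  have "(\<lambda>N. \<psi> N * (\<psi> (Suc N) - \<psi> N) + A * (\<psi> N)\<^sup>2) \<longlonglongrightarrow> 0 * (0 - 0) + A * 0\<^sup>2"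
    by (intro tendsto_intros LIMSEQ_Suc lim)
  moreover have "(\<lambda>N. (\<Sum>n<Suc N. \<psi> n * (half_schr V \<psi> n - 2 * \<psi> n)) - 2 * B\<^sup>2 * (\<Sum>n<Suc N. (\<psi> n)\<^sup>2))
      \<longlonglongrightarrow> ((\<Sum>n. \<psi> n * half_schr V \<psi> n) - 2 * (\<Sum>n. (\<psi> n)\<^sup>2)) - 2 * B\<^sup>2 * (\<Sum>n. (\<psi> n)\<^sup>2)"
  proof (intro tendsto_diff tendsto_mult tendsto_const LIMSEQ_Suc[OF summable_LIMSEQ[OF sm]])
    have "(\<lambda>n. \<psi> n * (half_schr V \<psi> n - 2 * \<psi> n)) sums
        ((\<Sum>n. \<psi> n * half_schr V \<psi> n) - 2 * (\<Sum>n. (\<psi> n)\<^sup>2))"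
      using sums_diff[OF summable_sums[OF h] sums_mult[OF summable_sums[OF sm], of 2]]
      by (simp add: algebra_simps power2_eq_square)
    then show "(\<lambda>N. \<Sum>n<Suc N. \<psi> n * (half_schr V \<psi> n - 2 * \<psi> n)) \<longlonglongrightarrow>
        (\<Sum>n. \<psi> n * half_schr V \<psi> n) - 2 * (\<Sum>n. (\<psi> n)\<^sup>2)"
      unfolding sums_def by (rule LIMSEQ_Suc)
  qed
  ultimately have "((\<Sum>n. \<psi> n * half_schr V \<psi> n) - 2 * (\<Sum>n. (\<psi> n)\<^sup>2)) - 2 * B\<^sup>2 * (\<Sum>n. (\<psi> n)\<^sup>2)
      \<le> 0 * (0 - 0) + A * 0\<^sup>2"
    using le by (intro LIMSEQ_le) blast+
  then show ?thesis by (simp add: B_def x_def power_divide algebra_simps)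
qed

section \<open>Variational counting of eigenvalues\<close>

lemma half_schr_sum:
  "finite I \<Longrightarrow> half_schr V (\<lambda>n. \<Sum>i\<in>I. c i * f i n) n = (\<Sum>i\<in>I. c i * half_schr V (f i) n)"
  by (simp add: half_schr_def sum.distrib sum_distrib_left algebra_simps)

text \<open>More than \<open>K + 1\<close> eigenfunctions have a nontrivial combination vanishing at
  all \<open>K + 1\<close> grid sites. By orthogonality its quadratic form exceeds
  \<open>\<tau>\<close> times its squared norm, against \<open>quadratic_form_le\<close>.\<close>

lemma card_eigenvalues_le:
  assumes V: "\<And>n. V n = F (Suc n) - F n" and F: "\<And>n. \<bar>F (Suc n)\<bar> \<le> A / real (Suc n)"
    and A: "A > 0" "4 * A \<le> real J"
    and I: "finite I"
      "\<And>E. E \<in> I \<Longrightarrow> half_eigenvalue V E \<and> E > 2 + 2 * A\<^sup>2 / (real (Suc (grid J K)))\<^sup>2"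
  shows "card I \<le> Suc K"
proof (rule ccontr)
  assume many: "\<not> card I \<le> Suc K"
  define \<tau> where "\<tau> = 2 + 2 * A\<^sup>2 / (real (Suc (grid J K)))\<^sup>2"
  from I(2) obtain f where f: "\<And>E. E \<in> I \<Longrightarrow> l2_seq (f E)"
    "\<And>E. E \<in> I \<Longrightarrow> f E \<noteq> (\<lambda>_. 0)" "\<And>E n. E \<in> I \<Longrightarrow> half_schr V (f E) n = E * f E n"
    unfolding half_eigenvalue_def by metis
  have "card (grid J ` {..K}) < card I"
    using many card_image_le[of "{..K}" "grid J"] by simp
  from exists_annihilating_combination[OF _ I(1) this, of f]
  obtain c where c: "\<exists>i\<in>I. c i \<noteq> 0" "\<And>j. j \<le> K \<Longrightarrow> (\<Sum>i\<in>I. c i * f i (grid J j)) = 0"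
    by auto
  define \<psi> where "\<psi> n = (\<Sum>i\<in>I. c i * f i n)" for n
  have sm: "summable (\<lambda>n. f i n * f j n)" if "i \<in> I" "j \<in> I" for i j
    using that f by (intro l2_seq_mult_summable) auto
  have inner: "(\<lambda>n. (\<Sum>i\<in>I. a i * f i n) * (\<Sum>j\<in>I. b j * f j n)) sums
      (\<Sum>i\<in>I. a i * b i * (\<Sum>n. (f i n)\<^sup>2))" for a b
  proof -
    have "(\<lambda>n. \<Sum>i\<in>I. \<Sum>j\<in>I. a i * b j * (f i n * f j n)) sums
        (\<Sum>i\<in>I. \<Sum>j\<in>I. a i * b j * (\<Sum>n. f i n * f j n))"
      by (intro sums_sum sums_mult summable_sums sm)
    moreover have "(\<Sum>j\<in>I. a i * b j * (\<Sum>n. f i n * f j n)) = a i * b i * (\<Sum>n. (f i n)\<^sup>2)"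
      if "i \<in> I" for i
    proof -
      have "(\<Sum>n. f i n * f j n) = 0" if "j \<in> I" "j \<noteq> i" for j
        using that \<open>i \<in> I\<close> f(1,3) by (intro eigenfunctions_orthogonal[of _ _ V i j]) auto
      then have "(\<Sum>j\<in>I. a i * b j * (\<Sum>n. f i n * f j n))
          = (\<Sum>j\<in>I. if j = i then a i * b i * (\<Sum>n. f i n * f i n) else 0)"
        by (intro sum.cong) auto
      then show ?thesis using that I(1) by (simp add: power2_eq_square)
    qed
    ultimately show ?thesis by (simp add: sum_product mult_ac)
  qed
  have h\<psi>: "half_schr V \<psi> n = (\<Sum>i\<in>I. c i * i * f i n)" for n
    unfolding \<psi>_def using I(1) f(3) by (simp add: half_schr_sum mult_ac)
  have s1: "(\<lambda>n. (\<psi> n)\<^sup>2) sums (\<Sum>i\<in>I. c i * c i * (\<Sum>n. (f i n)\<^sup>2))"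
    using inner[of c c] by (simp add: \<psi>_def power2_eq_square)
  have s2: "(\<lambda>n. \<psi> n * half_schr V \<psi> n) sums (\<Sum>i\<in>I. c i * (c i * i) * (\<Sum>n. (f i n)\<^sup>2))"
    using inner[of c "\<lambda>i. c i * i"] unfolding h\<psi> by (simp add: \<psi>_def)
  have "(\<Sum>n. \<psi> n * half_schr V \<psi> n) \<le> \<tau> * (\<Sum>n. (\<psi> n)\<^sup>2)"
    unfolding \<tau>_def
  proof (intro quadratic_form_le[where F = F] V F A)
    show "\<psi> (grid J j) = 0" if "j \<le> K" for j using c(2)[OF that] by (simp add: \<psi>_def)
  qed (use s1 s2 in \<open>auto simp: l2_seq_def sums_iff\<close>)
  then have "(\<Sum>i\<in>I. (i - \<tau>) * (c i)\<^sup>2 * (\<Sum>n. (f i n)\<^sup>2)) \<le> 0"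
    using s1 s2 by (simp add: sums_iff sum_distrib_left sum_subtractf algebra_simps power2_eq_square)
  moreover have "(\<Sum>i\<in>I. (i - \<tau>) * (c i)\<^sup>2 * (\<Sum>n. (f i n)\<^sup>2)) > 0"
  proof -
    have pos: "(\<Sum>n. (f i n)\<^sup>2) > 0" if "i \<in> I" for i
    proof -
      from f(2)[OF that] obtain n where "f i n \<noteq> 0" by (auto simp: fun_eq_iff)
      then show ?thesis using f(1)[OF that] by (intro suminf_pos2[of _ n]) (auto simp: l2_seq_def)
    qed
    obtain p where p: "p \<in> I" "c p \<noteq> 0" using c(1) by blast
    show ?thesis
    proof (rule sum_pos2[OF I(1) p(1)])
      show "0 < (p - \<tau>) * (c p)\<^sup>2 * (\<Sum>n. (f p n)\<^sup>2)"
        using I(2)[OF p(1)] p pos by (intro mult_pos_pos) (auto simp: \<tau>_def)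
      show "0 \<le> (i - \<tau>) * (c i)\<^sup>2 * (\<Sum>n. (f i n)\<^sup>2)" if "i \<in> I" for i
        using I(2)[OF that] pos[OF that] by (intro mult_nonneg_nonneg) (auto simp: \<tau>_def)
    qed
  qed
  ultimately show False by linarith
qed

subsection \<open>Enumeration of the bound states\<close>

text \<open>A maximiser of \<open>f\<close> is removed again and again. Finite superlevel sets
  ensure that maximisers exist and that no element is postponed forever.\<close>

lemma enumerate_decreasing:
  fixes f :: "'a \<Rightarrow> real"
  assumes "infinite B" "\<And>x. x \<in> B \<Longrightarrow> f x > 0" and fin: "\<And>\<epsilon>. \<epsilon> > 0 \<Longrightarrow> finite {x \<in> B. f x \<ge> \<epsilon>}"
  obtains e :: "nat \<Rightarrow> 'a" where "bij_betw e {1..} B" "\<And>m n. 1 \<le> m \<Longrightarrow> m \<le> n \<Longrightarrow> f (e n) \<le> f (e m)"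
proof -
  have max: "\<exists>x\<in>X. \<forall>y\<in>X. f y \<le> f x" if X: "X \<subseteq> B" "X \<noteq> {}" for X
  proof -
    obtain z where z: "z \<in> X" using X(2) by blast
    let ?Y = "{x \<in> X. f x \<ge> f z}"
    have "finite {x \<in> B. f x \<ge> f z}" using z X assms(2) by (intro fin) auto
    then have "finite ?Y" by (rule rev_finite_subset) (use X in auto)
    then have "Max (f ` ?Y) \<in> f ` ?Y" and ge: "\<And>y. y \<in> ?Y \<Longrightarrow> f y \<le> Max (f ` ?Y)"
      using z by (auto intro!: Max_in)
    then obtain x where x: "x \<in> ?Y" "f x = Max (f ` ?Y)" by auto
    have "f y \<le> f x" if "y \<in> X" for y
      using ge[of y] x that by (cases "f y \<ge> f z") auto
    then show ?thesis using x(1) by blast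
  qed
  define pick where "pick X = (SOME x. x \<in> X \<and> (\<forall>y\<in>X. f y \<le> f x))" for X
  define R where "R n = ((\<lambda>X. X - {pick X}) ^^ n) B" for n
  have R_Suc: "R (Suc n) = R n - {pick (R n)}" for n by (simp add: R_def)
  have R: "infinite (R n) \<and> R n \<subseteq> B" for n
    by (induction n) (use assms(1) in \<open>auto simp: R_def\<close>)
  have pick: "pick (R n) \<in> R n" "\<And>y. y \<in> R n \<Longrightarrow> f y \<le> f (pick (R n))" for n
  proof -
    have "R n \<subseteq> B" "R n \<noteq> {}" using R[of n] by auto
    from max[OF this] have "\<exists>x. x \<in> R n \<and> (\<forall>y\<in>R n. f y \<le> f x)" by blast
    from someI_ex[OF this]
    show "pick (R n) \<in> R n" "\<And>y. y \<in> R n \<Longrightarrow> f y \<le> f (pick (R n))" by (auto simp: pick_def)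
  qed
  have R_anti: "R n \<subseteq> R m" if "m \<le> n" for m n
    using that by (induction n rule: dec_induct) (auto simp: R_Suc)
  define g where "g n = pick (R n)" for n
  have dec: "f (g n) \<le> f (g m)" if "m \<le> n" for m n
    using pick R_anti[OF that] by (auto simp: g_def)
  have "g m \<noteq> g n" if "m < n" for m n
    using pick(1)[of n] R_anti[of "Suc m" n] that by (auto simp: g_def R_Suc)
  then have inj: "inj g" by (intro linorder_injI) auto
  have "range g = B"
  proof
    show "range g \<subseteq> B" using pick(1) R by (auto simp: g_def)
    show "B \<subseteq> range g"
    proof
      fix x assume x: "x \<in> B"
      show "x \<in> range g"
      proof (rule ccontr)
        assume "x \<notin> range g"
        then have xR: "x \<in> R n" for n
          using x by (induction n) (auto simp: R_Suc g_def, simp add: R_def)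
        have "g n \<in> B \<and> f x \<le> f (g n)" for n
          using pick(1)[of n] pick(2)[OF xR[of n]] R[of n] by (auto simp: g_def)
        then have "range g \<subseteq> {y \<in> B. f y \<ge> f x}" by auto
        then show False
          using fin[OF assms(2)[OF x]] inj by (metis finite_subset range_inj_infinite)
      qed
    qed
  qed
  with inj have "bij_betw g UNIV B" by (simp add: bij_betw_def)
  moreover have "bij_betw (\<lambda>n::nat. n - 1) {1..} UNIV"
    by (intro bij_betw_byWitness[where f' = Suc]) auto
  ultimately have "bij_betw (g \<circ> (\<lambda>n. n - 1)) {1..} B" by (rule bij_betw_trans[rotated])
  then show thesis using dec by (intro that[of "g \<circ> (\<lambda>n. n - 1)"]) auto
qed

text \<open>Multiplication by \<open>(-1)^n\<close> reverses the sign of the hopping terms.\<close>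

lemma half_eigenvalue_uminus:
  assumes "half_eigenvalue V E"
  shows "half_eigenvalue (\<lambda>n. - V n) (- E)"
proof -
  obtain \<phi> where \<phi>: "l2_seq \<phi>" "\<phi> \<noteq> (\<lambda>_. 0)" "\<And>n. half_schr V \<phi> n = E * \<phi> n"
    using assms unfolding half_eigenvalue_def by blast
  define \<psi> where "\<psi> n = (- 1) ^ n * \<phi> n" for n
  have "l2_seq \<psi>" using \<phi>(1)
    by (simp add: l2_seq_def \<psi>_def power_mult_distrib flip: power_mult)
  moreover have "\<psi> \<noteq> (\<lambda>_. 0)" using \<phi>(2) by (auto simp: \<psi>_def fun_eq_iff)
  moreover have "half_schr (\<lambda>n. - V n) \<psi> n = - E * \<psi> n" for n
  proof -
    have "half_schr (\<lambda>n. - V n) \<psi> n = - ((- 1) ^ n * half_schr V \<phi> n)"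
      by (cases n) (auto simp: half_schr_def \<psi>_def algebra_simps)
    then show ?thesis by (simp add: \<phi>(3) \<psi>_def)
  qed
  ultimately show ?thesis unfolding half_eigenvalue_def by blast
qed

text \<open>Positive and negative energies are counted separately, at most \<open>K + 1\<close>
  each. Here \<open>A = 32\<close> comes from \<open>abs_prim_Suc_le\<close>,
  \<open>J = 4 * A\<close>, \<open>2048 = 2 * A^2\<close>, and \<open>128 / 129\<close> inverts the
  growth factor \<open>1 + 1 / J\<close> of the grid.\<close>

lemma card_bound_states_le:
  assumes "finite I" "I \<subseteq> bound_states pot"
    and I: "\<And>E. E \<in> I \<Longrightarrow> \<bar>E\<bar> - 2 > 2048 * (128 / 129) ^ (2 * K)"
  shows "card I \<le> 2 * K + 2"
proof -
  have "real (Suc (grid 128 K)) \<ge> (129 / 128) ^ K"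
    using grid_lower[of 128 K] by simp
  then have "1 / (real (Suc (grid 128 K)))\<^sup>2 \<le> 1 / ((129 / 128) ^ K)\<^sup>2"
    by (intro divide_left_mono power_mono mult_pos_pos zero_less_power) auto
  also have "\<dots> = (128 / 129) ^ (2 * K)"
    by (simp add: power_divide flip: power_mult) (simp add: mult.commute)
  finally have le: "2 + 2 * 32\<^sup>2 / (real (Suc (grid 128 K)))\<^sup>2 \<le> 2 + 2048 * (128 / 129) ^ (2 * K)"
    by simp
  define P where "P = I \<inter> {0<..}"
  define N where "N = I \<inter> {..0}"
  have bs: "half_eigenvalue pot E" if "E \<in> I" for E using assms(2) that by (auto simp: bound_states_def)
  have "card P \<le> Suc K"
  proof (rule card_eigenvalues_le[where F = prim and A = 32 and J = 128 and V = pot])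
    show "half_eigenvalue pot E \<and> E > 2 + 2 * 32\<^sup>2 / (real (Suc (grid 128 K)))\<^sup>2" if "E \<in> P" for E
      using that bs I[of E] le by (auto simp: P_def)
  qed (use assms(1) pot_eq_prim_diff abs_prim_Suc_le in \<open>auto simp: P_def\<close>)
  moreover have "card (uminus ` N) \<le> Suc K"
  proof (rule card_eigenvalues_le[where F = "\<lambda>n. - prim n" and A = 32 and J = 128 and V = "\<lambda>n. - pot n"])
    show "half_eigenvalue (\<lambda>n. - pot n) E \<and> E > 2 + 2 * 32\<^sup>2 / (real (Suc (grid 128 K)))\<^sup>2"
      if "E \<in> uminus ` N" for E
      using that bs half_eigenvalue_uminus[of pot "- E"] I[of "- E"] le by (auto simp: N_def)
  qed (use assms(1) pot_eq_prim_diff abs_prim_Suc_le in \<open>auto simp: N_def\<close>)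
  moreover have "card (uminus ` N) = card N" by (intro card_image) (auto simp: inj_on_def)
  moreover have "card I = card P + card N"
  proof -
    have "I = P \<union> N" by (auto simp: P_def N_def)
    moreover have "card (P \<union> N) = card P + card N"
      using assms(1) by (intro card_Un_disjoint) (auto simp: P_def N_def)
    ultimately show ?thesis by simp
  qed
  ultimately show ?thesis by simp
qed

lemma many_bound_states:
  "\<exists>A \<subseteq> bound_states pot. finite A \<and> card A = n \<and> (\<forall>E\<in>A. \<bar>E\<bar> - 2 \<ge> (1 / 4) ^ Suc n)"
proof -
  have pos: "(0::real) < (1 / 4) ^ Suc n" by simp
  obtain A where A: "finite A" "card A = n" "\<forall>x\<in>A. half_eigenvalue pot x \<and> 2 + 1 / 4 ^ Suc n \<le> x"
    using eigenvalues_from_crossings[OF pot_tendsto_0 _ pot_crossings_ge[of n]] by auto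
  have E: "half_eigenvalue pot E" "2 + (1 / 4) ^ Suc n \<le> E" "E > 2" if "E \<in> A" for E
  proof -
    show "half_eigenvalue pot E" using A(3) that by blast
    show "2 + (1 / 4) ^ Suc n \<le> E" using A(3) that by (simp add: power_divide)
    then show "E > 2" using pos by linarith
  qed
  have "A \<subseteq> bound_states pot" using E by (fastforce simp: bound_states_def)
  moreover have "\<bar>E\<bar> - 2 \<ge> (1 / 4) ^ Suc n" if "E \<in> A" for E
    using E(2,3)[OF that] by linarith
  ultimately show ?thesis using A(1,2) by blast
qed

theorem theorem2p1:
  shows "\<exists>V :: nat \<Rightarrow> real.
     half_eigenvalue V 0 \<and>
     infinite (bound_states V) \<and>
     (\<exists>(E :: nat \<Rightarrow> real) (b :: real) (c :: real) (C\<^sub>1 :: real) (C\<^sub>2 :: real).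
        bij_betw E {1..} (bound_states V) \<and>
        (\<forall>n\<ge>1. \<bar>E (Suc n)\<bar> \<le> \<bar>E n\<bar>) \<and>
        0 < b \<and> b \<le> c \<and> c < 1 \<and> 0 < C\<^sub>1 \<and> 0 < C\<^sub>2 \<and>
        (\<forall>n\<ge>1. C\<^sub>1 * b ^ n \<le> \<bar>E n\<bar> - 2 \<and> \<bar>E n\<bar> - 2 \<le> C\<^sub>2 * c ^ n))"
proof -
  define B where "B = bound_states pot"
  define f where "f E = \<bar>E\<bar> - 2" for E :: real
  define c :: real where "c = 128 / 129"
  have c: "0 < c" "c < 1" by (simp_all add: c_def)
  have infinite: "infinite B"
  proof
    assume "finite B"
    moreover obtain A where "A \<subseteq> B" "card A = Suc (card B)"
      using many_bound_states[of "Suc (card B)"] unfolding B_def by blast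
    ultimately show False using card_mono[of B A] by simp
  qed
  have f_pos: "f E > 0" if "E \<in> B" for E using that by (auto simp: B_def bound_states_def f_def)
  have few: "card I \<le> 2 * K + 2" if "finite I" "I \<subseteq> B" "\<And>E. E \<in> I \<Longrightarrow> f E > 2048 * c ^ (2 * K)" for I K
    using that unfolding B_def f_def c_def by (intro card_bound_states_le)
  have "finite {E \<in> B. f E \<ge> \<epsilon>}" if \<epsilon>: "\<epsilon> > 0" for \<epsilon>
  proof (rule ccontr)
    assume inf: "\<not> ?thesis"
    obtain K where "c ^ K < \<epsilon> / 2048" using real_arch_pow_inv[of "\<epsilon> / 2048" c] \<epsilon> c by auto
    moreover have "c ^ (2 * K) \<le> c ^ K" using c by (intro power_decreasing) auto
    ultimately have K: "2048 * c ^ (2 * K) < \<epsilon>" by simp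
    obtain I where I: "I \<subseteq> {E \<in> B. f E \<ge> \<epsilon>}" "finite I" "card I = 2 * K + 3"
      using infinite_arbitrarily_large[OF inf] by blast
    then have "card I \<le> 2 * K + 2" using K by (intro few) force+
    with I show False by simp
  qed
  from enumerate_decreasing[of B f, OF infinite f_pos this]
  obtain e :: "nat \<Rightarrow> real" where e: "bij_betw e {1..} B" "\<And>m n. 1 \<le> m \<Longrightarrow> m \<le> n \<Longrightarrow> f (e n) \<le> f (e m)"
    by blast
  have eB: "e n \<in> B" if "n \<ge> 1" for n using e(1) that by (auto simp: bij_betw_def)
  have inj: "inj_on e {1..n}" for n using e(1) by (auto simp: bij_betw_def intro: inj_on_subset)
  have lower: "1 / 4 * (1 / 4) ^ n \<le> f (e n)" if n: "n \<ge> 1" for n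
  proof (rule ccontr)
    assume less: "\<not> ?thesis"
    obtain A where A: "A \<subseteq> B" "finite A" "card A = n" "\<And>E. E \<in> A \<Longrightarrow> f E \<ge> (1 / 4) ^ Suc n"
      using many_bound_states[of n] unfolding B_def f_def by blast
    \<comment> \<open>By monotonicity every index from \<open>n\<close> on lies below the threshold,
      which leaves too few indices for the \<open>n\<close> states in \<open>A\<close>.\<close>
    have "A \<subseteq> e ` {1..<n}"
    proof
      fix E assume E: "E \<in> A"
      then obtain m where m: "m \<ge> 1" "E = e m" using A(1) e(1) by (force simp: bij_betw_def)
      have "\<not> n \<le> m" using e(2)[OF n, of m] A(4)[OF E] less m by force
      then show "E \<in> e ` {1..<n}" using m by auto
    qed
    then have "card A \<le> card {1..<n}" by (intro surj_card_le) auto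
    then show False using A(3) n by simp
  qed
  \<comment> \<open>The first summand serves \<open>n \<ge> 3\<close>, where \<open>c ^ 4\<close>
    pays for rounding \<open>n\<close> up to \<open>2 * K + 4\<close>; the second serves
    \<open>n \<le> 2\<close>.\<close>
  define C\<^sub>2 where "C\<^sub>2 = 2048 / c ^ 4 + f (e 1) / c ^ 2"
  have C2: "C\<^sub>2 > 0" unfolding C\<^sub>2_def using c f_pos[OF eB[of 1]] by (intro add_pos_pos divide_pos_pos) auto
  have upper: "f (e n) \<le> C\<^sub>2 * c ^ n" if n: "n \<ge> 1" for n
  proof (cases "n \<le> 2")
    case True
    have "c\<^sup>2 \<le> c ^ n" using True c by (intro power_decreasing) auto
    then have "f (e 1) / c\<^sup>2 * c\<^sup>2 \<le> C\<^sub>2 * c ^ n"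
      unfolding C\<^sub>2_def using c f_pos[OF eB[of 1]] by (intro mult_mono) auto
    then show ?thesis using e(2)[of 1 n] n c by simp
  next
    case False
    \<comment> \<open>The largest \<open>K\<close> with \<open>2 * K + 2 < n\<close>, so that
      \<open>n\<close> states above the threshold contradict \<open>few\<close>.\<close>
    define K where "K = (n - 3) div 2"
    have K: "2 * K + 3 \<le> n" "n \<le> 4 + 2 * K" using False by (auto simp: K_def)
    have "f (e n) \<le> 2048 * c ^ (2 * K)"
    proof (rule ccontr)
      assume less: "\<not> ?thesis"
      have "f E > 2048 * c ^ (2 * K)" if "E \<in> e ` {1..n}" for E
        using that less e(2) by force
      then have "card (e ` {1..n}) \<le> 2 * K + 2" using eB by (intro few) auto
      then show False using K(1) by (simp only: card_image[OF inj] card_atLeastAtMost)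
    qed
    also have "c ^ (2 * K) = c ^ (4 + 2 * K) / c ^ 4" using c by (simp add: power_add)
    also have "2048 * \<dots> \<le> 2048 * (c ^ n / c ^ 4)"
      using c K by (intro mult_left_mono divide_right_mono power_decreasing) auto
    also have "\<dots> \<le> C\<^sub>2 * c ^ n"
      unfolding C\<^sub>2_def using c f_pos[OF eB[of 1]] by (simp add: distrib_right)
    finally show ?thesis .
  qed
  show ?thesis
  proof (rule exI[of _ pot], intro conjI)
    show "half_eigenvalue pot 0" by (rule half_eigenvalue_pot_0)
    show "infinite (bound_states pot)" using infinite by (simp add: B_def)
    have "bij_betw e {1..} (bound_states pot)" using e(1) by (simp add: B_def)
    moreover have "\<bar>e (Suc n)\<bar> \<le> \<bar>e n\<bar>" if "n \<ge> 1" for n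
      using e(2)[OF that, of "Suc n"] by (simp add: f_def)
    ultimately have all: "bij_betw e {1..} (bound_states pot)
        \<and> (\<forall>n\<ge>1. \<bar>e (Suc n)\<bar> \<le> \<bar>e n\<bar>)
        \<and> 0 < (1 / 4 :: real) \<and> 1 / 4 \<le> c \<and> c < 1 \<and> 0 < (1 / 4 :: real) \<and> 0 < C\<^sub>2
        \<and> (\<forall>n\<ge>1. 1 / 4 * (1 / 4) ^ n \<le> \<bar>e n\<bar> - 2 \<and> \<bar>e n\<bar> - 2 \<le> C\<^sub>2 * c ^ n)"
      using C2 lower upper by (simp add: f_def c_def)
    show "\<exists>E b c C\<^sub>1 C\<^sub>2. bij_betw E {1..} (bound_states pot) \<and>
        (\<forall>n\<ge>1. \<bar>E (Suc n)\<bar> \<le> \<bar>E n\<bar>) \<and>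
        0 < b \<and> b \<le> c \<and> c < 1 \<and> 0 < C\<^sub>1 \<and> 0 < C\<^sub>2 \<and>
        (\<forall>n\<ge>1. C\<^sub>1 * b ^ n \<le> \<bar>E n\<bar> - 2 \<and> \<bar>E n\<bar> - 2 \<le> C\<^sub>2 * c ^ n)"
      by (rule exI[of _ e], rule exI[of _ "1 / 4"], rule exI[of _ c], rule exI[of _ "1 / 4"],
          rule exI[of _ C\<^sub>2], rule all)
  qed
qed

end
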